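(* For every $k \ge 3$ and every $\epsilon > 0$, there is a non-degenerate holomorphic mapping $G : \mathbb{C}^k \to \mathbb{C}^k$ such that the range $G(\mathbb{C}^k)$ avoids (is disjoint from) the closure of the unit polydisc $D^k(0,1)$ but contains the complement $\mathbb{C}^k \setminus D^k(0,1+\epsilon)$ of the larger polydisc $D^k(0,1+\epsilon)$. Moreover, for each $w \in G(\mathbb{C}^k)$, the cardinality of the fibre $G^{-1}(w)$ is at most $n^k$, where $n$ is a positive integer depending only on $\epsilon$.
   Context: For $r>0$, $D^k(0,r) = \{z=(z_1,\dots,z_k) \in \mathbb{C}^k : |z_j| < r \text{ for } 1 \le j \le k\}$ is the open polydisc around the origin with radius $r$ in each coordinate direction. A holomorphic map $\mathbb{C}^k \to \mathbb{C}^k$ is non-degenerate if its Jacobian determinant does not vanish identically. *)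

theory Defs
  imports "HOL-Complex_Analysis.Complex_Analysis" "Jordan_Normal_Form.Determinant"
begin

text \<open>The space of \<open>k\<close>-tuples of complex numbers for a variable \<open>k\<close>: its points are the functions
  that are arbitrary on \<open>{..<k}\<close> and \<open>undefined\<close> elsewhere, so coordinates are numbered from 0.\<close>

definition complex_space :: "nat \<Rightarrow> (nat \<Rightarrow> complex) topology" where
  "complex_space k = product_topology (\<lambda>_. euclidean) {..<k}"

definition polydisc :: "nat \<Rightarrow> real \<Rightarrow> (nat \<Rightarrow> complex) set" where
  "polydisc k r = {z \<in> topspace (complex_space k). \<forall>j<k. cmod (z j) < r}"

text \<open>Holomorphy in several variables: joint continuity together with holomorphy of every component
  in each variable separately.\<close>

definition entire_map :: "nat \<Rightarrow> ((nat \<Rightarrow> complex) \<Rightarrow> (nat \<Rightarrow> complex)) \<Rightarrow> bool" where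
  "entire_map k G \<longleftrightarrow>
     continuous_map (complex_space k) (complex_space k) G \<and>
     (\<forall>z \<in> topspace (complex_space k). \<forall>i<k. \<forall>j<k.
        (\<lambda>t. G (z(j := t)) i) holomorphic_on UNIV)"

definition jacobian_matrix ::
    "nat \<Rightarrow> ((nat \<Rightarrow> complex) \<Rightarrow> (nat \<Rightarrow> complex)) \<Rightarrow> (nat \<Rightarrow> complex) \<Rightarrow> complex mat" where
  "jacobian_matrix k G z = mat k k (\<lambda>(i, j). deriv (\<lambda>t. G (z(j := t)) i) (z j))"

definition nondegenerate :: "nat \<Rightarrow> ((nat \<Rightarrow> complex) \<Rightarrow> (nat \<Rightarrow> complex)) \<Rightarrow> bool" where
  "nondegenerate k G \<longleftrightarrow>
     (\<exists>z \<in> topspace (complex_space k). Determinant.det (jacobian_matrix k G z) \<noteq> 0)"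

end

theory Submission
  imports Defs "HOL-Real_Asymp.Real_Asymp"
begin

text \<open>The map is built backwards from the target, as a composition \<open>G = P \<circ> A \<circ> Q \<circ> B \<circ> F\<close> in which \<open>P\<close>
and \<open>Q\<close> are finite branched coverings by powers, \<open>A\<close> and \<open>B\<close> are shears, and \<open>F\<close> is an
injective holomorphic map acting on the coordinates 0 and 1 only. Along the way two sets are followed:
the \<^emph>\<open>bad\<close> set, which is the full preimage of the closed unit polydisc and has to be avoided, and a
\<^emph>\<open>good\<close> set, which contains at least one preimage of every point outside the larger polydisc and has to
be covered. Passing to a branched cover enlarges the bad set to its whole preimage, but of the good set
it suffices to keep one conveniently chosen root for each point.

\<^item> \<open>P\<close> raises each coordinate to the power \<open>n = 4 * b\<close>. Every complex number has an \<open>n\<close>-th root \<open>v\<close> that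
lies in a narrow sector around the positive real axis and for which \<open>v ^ m\<close> lies in a fixed sector in the
right half-plane, for an exponent \<open>m\<close> that may be much larger than \<open>n\<close>. Since \<open>m\<close> is large, the small gap
between the moduli \<open>1\<close> and \<open>1 + \<epsilon>\<close> becomes an arbitrarily large gap for \<open>v ^ m\<close>; so
\<open>exp (- (a * (\<Sum>i. v i ^ m)))\<close>, with the sum over all coordinates but the last, is close to 1 on the bad
set, has modulus at most 1 on the good set, and is at most 1/2 in modulus on the good set whenever one of
these coordinates is outside the larger disc.

\<^item> \<open>A\<close> shears the last coordinate by this cutoff. In the new last coordinate \<open>u\<close> the bad set lies in a disc
of radius slightly larger than 1, while on the good set the real part of \<open>u\<close> is at least a constant
\<open>c > 1\<close>: either the last coordinate was already outside the larger disc, or the shear has moved it to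
the right. A single coordinate now separates the two sets.

\<^item> \<open>Q\<close> substitutes \<open>u = y ^ 4\<close>. Choosing the root \<open>y\<close> so that a high power \<open>y ^ q\<close> lies in a sector in the
right half-plane makes \<open>exp (- (A * y ^ q))\<close> almost 1 on the bad set and almost 0 on the good set.

\<^item> \<open>B\<close> uses this function to shift the coordinates 0 and 1. It takes the bad set far to the left in both
coordinates and leaves the good set in a right half-plane in both. This is where three coordinates are
used: two that are shifted and one that controls the shift.

\<^item> \<open>F\<close> is a Fatou-Bieberbach map: the limit of \<open>T 0 \<circ> \<dots> \<circ> T (d - 1)\<close> for automorphisms \<open>T n\<close> of the plane that
are close to the identity on half-planes growing with \<open>n\<close> and whose inverses, applied one after the other,
carry the bad set to infinity. Its range therefore misses the bad set (\<open>limmap_avoids\<close>) and contains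
the good set (\<open>limmap_covers\<close>).

\<open>F\<close> is injective, so a fibre of \<open>G\<close> has at most \<open>n ^ k * 4\<close> points. The Jacobian matrix is nonsingular at
a preimage of a point with nonzero coordinates, because \<open>F\<close> is so close to the identity there that
Cauchy's estimate makes its derivative invertible.\<close>

section \<open>An entire function that switches between two constants\<close>

lemma norm_exp_minus_one_le:
  fixes z :: complex
  assumes "cmod z \<le> 1"
  shows "cmod (exp z - 1) \<le> 3 * cmod z"
proof -
  have "cmod (exp z - exp 0) \<le> 3 * cmod (z - 0)"
  proof (rule field_differentiable_bound[where S = "cball 0 1" and f' = exp])
    fix w :: complex assume w: "w \<in> cball 0 1"
    show "(exp has_field_derivative exp w) (at w within cball 0 1)"
      by (auto intro!: derivative_eq_intros)
    have "cmod (exp w) \<le> exp (cmod w)"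
      by (rule norm_exp)
    also have "\<dots> \<le> exp 1" using w by simp
    also have "\<dots> \<le> 3" by (rule exp_le)
    finally show "cmod (exp w) \<le> 3" .
  qed (use assms in auto)
  then show ?thesis by simp
qed

text \<open>The function is nearly 0 on a right half-plane and nearly 10 on the left part of a horizontal strip.
The argument \<open>z + of_nat (5 * n + 4008)\<close> moves the transition to the left as \<open>n\<close> grows. In the strip the
factor 1/4 bounds the argument of the inner exponential by 1, so that the outer exponential
decays there. An inverse shear by \<open>push n\<close> subtracts about 10 from the real part of points far to the left;
this exceeds the distance 9 by which \<open>left_region n\<close> below moves when \<open>n\<close> increases by 1.\<close>

definition push :: "nat \<Rightarrow> complex \<Rightarrow> complex" where
  "push n z = 10 * (1 - exp (- exp (- (z + of_nat (5 * n + 4008)) / 4)))"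

definition tol :: "nat \<Rightarrow> real" where
  "tol n = (1/2) ^ n / 32"

lemma tol_pos [intro!]: "tol n > 0" and tol_nonneg [intro!]: "tol n \<ge> 0"
  and tol_Suc: "tol (Suc n) = tol n / 2" and tol_le: "tol n \<le> 1 / 32"
  by (auto simp: tol_def power_le_one)

text \<open>Both sides of the transition of \<open>push n\<close> are controlled by \<open>exp (- (real n + 1000))\<close>; the summand 1000
leaves ample room for the factors that occur.\<close>

lemma exp_shift_le_tol: "exp (- (real n + 1000)) \<le> tol n / 30"
proof -
  have "exp (- real n) \<le> (1/2) ^ n"
  proof -
    have "exp (- real n) = exp (-1) ^ n"
      by (simp add: exp_of_nat_mult[symmetric])
    also have "\<dots> \<le> (1/2) ^ n"
    proof (rule power_mono)
      have "2 \<le> exp (1::real)" using exp_ge_add_one_self[of 1] by simp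
      then show "exp (-1) \<le> (1/2::real)" by (simp add: exp_minus field_simps)
    qed simp
    finally show ?thesis .
  qed
  moreover have "exp (- 1000 :: real) \<le> 1 / 960"
    using exp_ge_add_one_self[of 1000] by (simp add: exp_minus field_simps)
  ultimately have "exp (- real n) * exp (- 1000 :: real) \<le> (1/2) ^ n * (1 / 960)"
    by (intro mult_mono) auto
  then show ?thesis by (simp add: tol_def exp_diff exp_minus field_simps)
qed

lemma push_right:
  assumes "Re z \<ge> - (real n + 8)"
  shows "cmod (push n z) \<le> tol n"
    and "\<exists>D. (push n has_field_derivative D) (at z) \<and> cmod D \<le> tol n"
proof -
  define u where "u = exp (- (z + of_nat (5 * n + 4008)) / 4)"
  have "cmod u = exp (- (Re z + real (5 * n + 4008)) / 4)"
    by (simp add: u_def)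
  also have "\<dots> \<le> exp (- (real n + 1000))" using assms by simp
  also have "\<dots> \<le> tol n / 30" by (rule exp_shift_le_tol)
  finally have u: "cmod u \<le> tol n / 30" .
  then have u1: "cmod u \<le> 1" using tol_le[of n] by simp
  have "push n z = - (10 * (exp (- u) - 1))" by (simp add: push_def u_def)
  then have "cmod (push n z) = 10 * cmod (exp (- u) - 1)"
    by (simp only: norm_minus_cancel norm_mult norm_numeral)
  also have "\<dots> \<le> 10 * (3 * cmod u)"
    using norm_exp_minus_one_le[of "- u"] u1 by simp
  finally show "cmod (push n z) \<le> tol n" using u by simp
  define D where "D = - (10 * exp (- u) * u / 4)"
  have "(push n has_field_derivative D) (at z)"
    unfolding push_def D_def u_def
    by (auto intro!: derivative_eq_intros simp: field_simps)
  moreover have "cmod D \<le> tol n"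
  proof -
    have "cmod (exp (- u)) \<le> exp (cmod (- u))" by (rule norm_exp)
    also have "\<dots> \<le> exp 1" using u1 by simp
    also have "\<dots> \<le> 3" by (rule exp_le)
    finally have "cmod (exp (- u)) * cmod u \<le> 3 * (tol n / 30)"
      using u by (intro mult_mono) auto
    moreover have "cmod D = 5 / 2 * (cmod (exp (- u)) * cmod u)"
      by (simp add: D_def norm_mult norm_divide)
    ultimately show ?thesis using tol_nonneg[of n] by linarith
  qed
  ultimately show "\<exists>D. (push n has_field_derivative D) (at z) \<and> cmod D \<le> tol n" by blast
qed

text \<open>In the strip the inner exponential \<open>u\<close> has real part at least \<open>exp (real n + 1000) / 2\<close>, since its argument
is at most \<open>1 \<le> pi / 3\<close>, and the error is \<open>- 10 * exp (- u)\<close>.\<close>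

lemma push_left:
  assumes "Re z \<le> - (9 * real n + 8008)" "\<bar>Im z\<bar> \<le> 4"
  shows "cmod (push n z - 10) \<le> tol n"
proof -
  define t where "t = - (Re z + real (5 * n + 4008)) / 4"
  define u where "u = exp (- (z + of_nat (5 * n + 4008)) / 4)"
  have t: "t \<ge> real n + 1000" using assms by (simp add: t_def)
  have "cos (pi / 3) \<le> cos \<bar>Im z / 4\<bar>"
    using assms(2) pi_gt3 by (intro cos_monotone_0_pi_le) auto
  then have "cos (pi / 3) \<le> cos (Im z / 4)" by (simp only: cos_abs_real)
  then have c: "cos (Im z / 4) \<ge> 1 / 2" by (simp add: cos_60)
  have "t \<le> (t / 2)\<^sup>2 * (1 / 2)"
  proof -
    have "8 * t \<le> t * t" using t by (intro mult_right_mono) auto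
    then show ?thesis by (simp add: power2_eq_square)
  qed
  also have "\<dots> \<le> exp (t / 2) ^ 2 * (1 / 2)"
  proof -
    have "t / 2 \<le> exp (t / 2)" using exp_ge_add_one_self[of "t / 2"] by linarith
    then show ?thesis using t by (intro mult_right_mono power_mono) auto
  qed
  also have "\<dots> = exp t * (1 / 2)" by (simp add: exp_double[symmetric])
  also have "\<dots> \<le> exp t * cos (Im z / 4)" using c by (intro mult_left_mono) auto
  also have "\<dots> = Re u" by (simp add: u_def t_def Re_exp)
  finally have "exp (- Re u) \<le> exp (- (real n + 1000))" using t by simp
  also have "\<dots> \<le> tol n / 30" by (rule exp_shift_le_tol)
  finally have "10 * exp (- Re u) \<le> tol n" using tol_nonneg[of n] by linarith
  moreover have "cmod (push n z - 10) = 10 * exp (- Re u)"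
  proof -
    have "push n z - 10 = - (10 * exp (- u))" by (simp add: push_def u_def)
    then show ?thesis by (simp add: norm_mult)
  qed
  ultimately show ?thesis by simp
qed

lemma push_lipschitz:
  assumes "Re z \<ge> - (real n + 8)" "Re w \<ge> - (real n + 8)"
  shows "cmod (push n z - push n w) \<le> tol n * cmod (z - w)"
proof -
  let ?S = "{z. Re z \<ge> - (real n + 8)}"
  have "\<forall>z\<in>?S. \<exists>D. (push n has_field_derivative D) (at z) \<and> cmod D \<le> tol n"
    using push_right(2) by blast
  then obtain D where D: "\<And>z. z \<in> ?S \<Longrightarrow> (push n has_field_derivative D z) (at z) \<and> cmod (D z) \<le> tol n"
    by metis
  show ?thesis
    by (rule field_differentiable_bound[where S = ?S and f' = D])
      (use D assms in \<open>auto intro: has_field_derivative_at_within convex_halfspace_Re_ge\<close>)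
qed

lemma push_holomorphic [holomorphic_intros]:
  "f holomorphic_on S \<Longrightarrow> (\<lambda>t. push n (f t)) holomorphic_on S"
  unfolding push_def by (intro holomorphic_intros) auto

lemma push_continuous [continuous_intros]:
  "continuous_on S f \<Longrightarrow> continuous_on S (\<lambda>t. push n (f t))"
  unfolding push_def by (intro continuous_intros) auto

section \<open>Infinite compositions of shears of the plane\<close>

type_synonym plane = "complex \<times> complex"

definition xshear :: "nat \<Rightarrow> plane \<Rightarrow> plane" where
  "xshear n p = p + (push n (snd p), 0)"

definition yshear :: "nat \<Rightarrow> plane \<Rightarrow> plane" where
  "yshear n p = p + (0, push n (fst p))"

definition step :: "nat \<Rightarrow> plane \<Rightarrow> plane" where
  "step n p = yshear n (xshear n p)"

definition step_inv :: "nat \<Rightarrow> plane \<Rightarrow> plane" where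
  "step_inv n q = (let r = q - (0, push n (fst q)) in r - (push n (snd r), 0))"

lemma step_step_inv: "step n (step_inv n q) = q"
  by (simp add: step_def step_inv_def xshear_def yshear_def Let_def prod_eq_iff)

lemma step_inv_step: "step_inv n (step n p) = p"
  by (simp add: step_def step_inv_def xshear_def yshear_def Let_def prod_eq_iff)

text \<open>Products of two right half-planes. They exhaust the plane as \<open>r\<close> grows, and \<open>step n\<close> is close to the
identity uniformly on the one with \<open>r = real n + 7\<close>.\<close>

definition quadrant :: "real \<Rightarrow> plane set" where
  "quadrant r = {p. Re (fst p) \<ge> - r \<and> Re (snd p) \<ge> - r}"

lemma norm_fst_plane: "cmod (fst p) \<le> norm p" and norm_snd_plane: "cmod (snd p) \<le> norm p"
  for p :: plane
  by (cases p; simp add: norm_fst_le norm_snd_le)+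

lemma quadrant_mono: "p \<in> quadrant r \<Longrightarrow> r \<le> s \<Longrightarrow> p \<in> quadrant s"
  by (auto simp: quadrant_def)

lemma quadrant_perturb:
  assumes "p \<in> quadrant r" "norm (q - p) \<le> d"
  shows "q \<in> quadrant (r + d)"
proof -
  have "\<bar>Re (fst q) - Re (fst p)\<bar> \<le> d"
    using abs_Re_le_cmod[of "fst (q - p)"] norm_fst_plane[of "q - p"] assms(2)
    by auto
  moreover have "\<bar>Re (snd q) - Re (snd p)\<bar> \<le> d"
    using abs_Re_le_cmod[of "snd (q - p)"] norm_snd_plane[of "q - p"] assms(2)
    by auto
  ultimately show ?thesis using assms(1) by (auto simp: quadrant_def)
qed

lemma exists_quadrant: "\<exists>N. p \<in> quadrant (real N)"
proof -
  obtain N :: nat where "real N \<ge> max (- Re (fst p)) (- Re (snd p))"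
    using real_arch_simple by blast
  then show ?thesis by (auto simp: quadrant_def intro!: exI[of _ N])
qed

lemma closed_quadrant: "closed (quadrant r)"
  unfolding quadrant_def by (intro closed_Collect_conj closed_Collect_le continuous_intros)

lemma xshear_near:
  assumes "p \<in> quadrant (real n + 8)"
  shows "norm (xshear n p - p) \<le> tol n"
    and "q \<in> quadrant (real n + 8) \<Longrightarrow>
      norm (xshear n p - xshear n q) \<le> (1 + tol n) * norm (p - q)"
proof -
  show "norm (xshear n p - p) \<le> tol n"
    using assms push_right(1)[of n "snd p"] by (simp add: xshear_def norm_Pair quadrant_def)
  assume q: "q \<in> quadrant (real n + 8)"
  have "xshear n p - xshear n q = (p - q) + (push n (snd p) - push n (snd q), 0)"
    by (simp add: xshear_def prod_eq_iff)
  then have "norm (xshear n p - xshear n q)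
      \<le> norm (p - q) + cmod (push n (snd p) - push n (snd q))"
    using norm_triangle_ineq[of "p - q" "(push n (snd p) - push n (snd q), 0)"]
    by (simp add: norm_Pair)
  also have "\<dots> \<le> norm (p - q) + tol n * cmod (snd p - snd q)"
    using push_lipschitz[of n "snd p" "snd q"] assms q by (simp add: quadrant_def)
  also have "\<dots> \<le> norm (p - q) + tol n * norm (p - q)"
    using norm_snd_plane[of "p - q"]
    by (intro add_left_mono mult_left_mono) auto
  finally show "norm (xshear n p - xshear n q) \<le> (1 + tol n) * norm (p - q)"
    by (simp add: algebra_simps)
qed

lemma yshear_near:
  assumes "p \<in> quadrant (real n + 8)"
  shows "norm (yshear n p - p) \<le> tol n"
    and "q \<in> quadrant (real n + 8) \<Longrightarrow>
      norm (yshear n p - yshear n q) \<le> (1 + tol n) * norm (p - q)"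
proof -
  have swap: "yshear n p = prod.swap (xshear n (prod.swap p))" for p
    by (simp add: xshear_def yshear_def prod_eq_iff)
  have norm_swap: "norm (prod.swap a - prod.swap b) = norm (a - b)" for a b :: plane
    by (simp add: norm_prod_def add.commute)
  have mem: "prod.swap p \<in> quadrant r \<longleftrightarrow> p \<in> quadrant r" for p r
    by (auto simp: quadrant_def)
  show "norm (yshear n p - p) \<le> tol n"
    using xshear_near(1)[of "prod.swap p" n] assms norm_swap[of "xshear n (prod.swap p)" "prod.swap p"]
    by (simp add: swap mem)
  assume q: "q \<in> quadrant (real n + 8)"
  show "norm (yshear n p - yshear n q) \<le> (1 + tol n) * norm (p - q)"
    using xshear_near(2)[of "prod.swap p" n "prod.swap q"] assms q
    by (simp add: swap mem norm_swap)
qed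

lemma step_near:
  assumes "p \<in> quadrant (real n + 7)"
  shows "norm (step n p - p) \<le> 2 * tol n"
    and "q \<in> quadrant (real n + 7) \<Longrightarrow> norm (step n p - step n q) \<le> (1 + 4 * tol n) * norm (p - q)"
proof -
  have x: "xshear n p \<in> quadrant (real n + 8)" "p \<in> quadrant (real n + 8)"
    if "p \<in> quadrant (real n + 7)" for p
  proof -
    show p: "p \<in> quadrant (real n + 8)" using that by (rule quadrant_mono) simp
    have "norm (xshear n p - p) \<le> 1" using xshear_near(1)[OF p] tol_le[of n] by simp
    from quadrant_perturb[OF that this] show "xshear n p \<in> quadrant (real n + 8)" by (simp add: add.commute)
  qed
  have "norm (step n p - p) \<le> norm (step n p - xshear n p) + norm (xshear n p - p)"
    using norm_triangle_ineq[of "step n p - xshear n p" "xshear n p - p"] by simp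
  also have "\<dots> \<le> tol n + tol n"
    using yshear_near(1)[OF x(1)[OF assms]] xshear_near(1)[OF x(2)[OF assms]]
    unfolding step_def by (intro add_mono)
  finally show "norm (step n p - p) \<le> 2 * tol n" by simp
  assume q: "q \<in> quadrant (real n + 7)"
  have "norm (step n p - step n q) \<le> (1 + tol n) * norm (xshear n p - xshear n q)"
    unfolding step_def using yshear_near(2) x(1) assms q by blast
  also have "\<dots> \<le> (1 + tol n) * ((1 + tol n) * norm (p - q))"
    by (intro mult_left_mono xshear_near(2) x(2) assms q add_nonneg_nonneg) auto
  also have "\<dots> = (1 + tol n * (2 + tol n)) * norm (p - q)" by (simp add: algebra_simps)
  also have "\<dots> \<le> (1 + tol n * 4) * norm (p - q)"
    using tol_le[of n] by (intro mult_right_mono add_left_mono mult_left_mono) auto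
  finally show "norm (step n p - step n q) \<le> (1 + 4 * tol n) * norm (p - q)"
    by (simp add: mult.commute)
qed

lemma continuous_step: "continuous_on S (step n)"
  unfolding step_def xshear_def yshear_def by (intro continuous_intros)

text \<open>The composition \<open>step m \<circ> step (m + 1) \<circ> \<dots> \<circ> step (m + d - 1)\<close>. New maps enter on the inside: they act
first and are closest to the identity, which makes the compositions converge.\<close>

fun iter :: "nat \<Rightarrow> nat \<Rightarrow> plane \<Rightarrow> plane" where
  "iter m 0 p = p"
| "iter m (Suc d) p = step m (iter (Suc m) d p)"

lemma iter_Suc_right: "iter m (Suc d) p = iter m d (step (m + d) p)"
proof (induction d arbitrary: m)
  case (Suc d)
  have "iter m (Suc (Suc d)) p = step m (iter (Suc m) (Suc d) p)" by (rule iter.simps)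
  also have "\<dots> = step m (iter (Suc m) d (step (Suc m + d) p))" by (simp only: Suc.IH)
  finally show ?case by simp
qed simp

text \<open>The displacements \<open>2 * tol i\<close> of the single steps form a geometric series with sum \<open>4 * tol m\<close>, which is
small enough that no intermediate point leaves the region where the next step is controlled.\<close>

lemma iter_displacement:
  "p \<in> quadrant (real m + 6) \<Longrightarrow> norm (iter m d p - p) \<le> 4 * tol m"
proof (induction d arbitrary: m)
  case (Suc d)
  let ?q = "iter (Suc m) d p"
  have 1: "norm (?q - p) \<le> 4 * tol (Suc m)"
    using Suc.IH[of "Suc m"] Suc.prems quadrant_mono[of p "real m + 6" "real (Suc m) + 6"] by simp
  then have "norm (?q - p) \<le> 1" using tol_le[of "Suc m"] by simp
  from quadrant_perturb[OF Suc.prems this] have "?q \<in> quadrant (real m + 7)" by (simp add: add.commute)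
  from step_near(1)[OF this] have "norm (step m ?q - ?q) \<le> 2 * tol m" .
  with 1 norm_triangle_ineq[of "step m ?q - ?q" "?q - p"] show ?case by (simp add: tol_Suc)
qed auto

lemma iter_lipschitz:
  assumes "p \<in> quadrant (real m + 6)" "q \<in> quadrant (real m + 6)"
  shows "norm (iter m d p - iter m d q) \<le> 2 * norm (p - q)"
proof -
  have "norm (iter m d p - iter m d q) \<le> (1 + 16 * tol m) * norm (p - q)"
    using assms
  proof (induction d arbitrary: m)
    case (Suc d)
    let ?a = "iter (Suc m) d p" and ?b = "iter (Suc m) d q"
    have pq: "p \<in> quadrant (real (Suc m) + 6)" "q \<in> quadrant (real (Suc m) + 6)"
      using Suc.prems by (auto intro: quadrant_mono)
    have 1: "norm (?a - ?b) \<le> (1 + 16 * tol (Suc m)) * norm (p - q)"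
      by (rule Suc.IH[OF pq])
    have q7: "r \<in> quadrant (real m + 6) \<Longrightarrow> iter (Suc m) d r \<in> quadrant (real m + 7)" for r
    proof -
      assume r: "r \<in> quadrant (real m + 6)"
      have "norm (iter (Suc m) d r - r) \<le> 1"
        using iter_displacement[of r "Suc m" d] tol_le[of "Suc m"] quadrant_mono[OF r, of "real (Suc m) + 6"]
        by simp
      from quadrant_perturb[OF r this] show ?thesis by (simp add: add.commute)
    qed
    have "norm (step m ?a - step m ?b) \<le> (1 + 4 * tol m) * norm (?a - ?b)"
      using step_near(2) q7 Suc.prems by blast
    also have "\<dots> \<le> (1 + 4 * tol m) * ((1 + 8 * tol m) * norm (p - q))"
      using 1 by (intro mult_left_mono add_nonneg_nonneg) (auto simp: tol_Suc)
    also have "\<dots> = (1 + tol m * (12 + 32 * tol m)) * norm (p - q)" by (simp add: algebra_simps)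
    also have "\<dots> \<le> (1 + tol m * 16) * norm (p - q)"
      using tol_le[of m] by (intro mult_right_mono add_left_mono mult_left_mono) auto
    finally show ?case by (simp add: mult.commute)
  next
    case 0
    have "1 * norm (p - q) \<le> (1 + 16 * tol m) * norm (p - q)"
      by (intro mult_right_mono) auto
    then show ?case by simp
  qed
  also have "\<dots> \<le> 2 * norm (p - q)"
    using tol_le[of m] by (intro mult_right_mono) auto
  finally show ?thesis .
qed

lemma continuous_iter: "continuous_on S (iter m d)"
proof -
  have "continuous_on UNIV (iter m d)"
  proof (induction d arbitrary: m)
    case (Suc d)
    have "continuous_on UNIV (step m \<circ> iter (Suc m) d)"
      by (intro continuous_on_compose Suc continuous_step)
    then show ?case by (simp add: comp_def)
  qed simp
  then show ?thesis by (rule continuous_on_subset) simp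
qed

definition limmap :: "nat \<Rightarrow> plane \<Rightarrow> plane" where
  "limmap m p = lim (\<lambda>d. iter m d p)"

lemma tol_shift: "tol (m + d) = tol m * (1/2) ^ d"
  by (simp add: tol_def power_add)

text \<open>Consecutive compositions differ by an innermost \<open>step (m + d)\<close>, which moves the argument by
\<open>2 * tol (m + d)\<close>, followed by a map with Lipschitz constant 2; so the M-test applies to the
telescoping series.\<close>

lemma uniform_limit_iter:
  "uniform_limit (quadrant (real m + 5)) (iter m) (limmap m) sequentially"
proof -
  let ?f = "\<lambda>d p. iter m (Suc d) p - iter m d p"
  have bound: "norm (?f d p) \<le> 4 * tol (m + d)" if p: "p \<in> quadrant (real m + 5)" for d p
  proof -
    have p7: "p \<in> quadrant (real (m + d) + 7)" and p6: "p \<in> quadrant (real m + 6)"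
      using p by (auto intro: quadrant_mono)
    have s: "norm (step (m + d) p - p) \<le> 2 * tol (m + d)" by (rule step_near(1)[OF p7])
    then have "norm (step (m + d) p - p) \<le> 1" using tol_le[of "m + d"] by simp
    from quadrant_perturb[OF p this] have "step (m + d) p \<in> quadrant (real m + 6)" by (simp add: add.commute)
    from iter_lipschitz[OF this p6, of d] s show ?thesis by (simp add: iter_Suc_right del: iter.simps)
  qed
  have "uniform_limit (quadrant (real m + 5)) (\<lambda>n p. \<Sum>i<n. ?f i p) (\<lambda>p. suminf (\<lambda>i. ?f i p)) sequentially"
    by (rule Weierstrass_m_test[where M = "\<lambda>d. 4 * tol (m + d)"])
      (use bound in \<open>auto simp: tol_shift intro!: summable_mult summable_geometric\<close>)
  then have "uniform_limit (quadrant (real m + 5)) (\<lambda>n p. (\<Sum>i<n. ?f i p) + p)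
      (\<lambda>p. suminf (\<lambda>i. ?f i p) + p) sequentially"
    by (intro uniform_limit_add uniform_limit_const)
  moreover have "(\<Sum>i<n. ?f i p) + p = iter m n p" for n p
    by (subst sum_lessThan_telescope) simp
  ultimately have ul: "uniform_limit (quadrant (real m + 5)) (iter m) (\<lambda>p. suminf (\<lambda>i. ?f i p) + p) sequentially"
    by simp
  have "limmap m p = suminf (\<lambda>i. ?f i p) + p" if "p \<in> quadrant (real m + 5)" for p
    unfolding limmap_def by (rule limI[OF tendsto_uniform_limitI[OF ul that]])
  with ul show ?thesis by (subst uniform_limit_cong') auto
qed

text \<open>A point lies in the region of uniform convergence for all large \<open>m\<close>; convergence for smaller \<open>m\<close>
follows because \<open>iter m (Suc d) p\<close> is a continuous function of \<open>iter (Suc m) d p\<close>.\<close>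

lemma iter_tendsto: "(\<lambda>d. iter m d p) \<longlonglongrightarrow> limmap m p"
proof -
  obtain N where N: "p \<in> quadrant (real N)" using exists_quadrant by blast
  have "convergent (\<lambda>d. iter m d p)"
  proof (cases "m \<le> N")
    case True
    then show ?thesis
    proof (induction rule: inc_induct)
      case base
      have "p \<in> quadrant (real N + 5)" using N by (rule quadrant_mono) simp
      then show ?case using tendsto_uniform_limitI[OF uniform_limit_iter] convergentI by blast
    next
      case (step j)
      then obtain L where "(\<lambda>d. iter (Suc j) d p) \<longlonglongrightarrow> L" by (auto simp: convergent_def)
      then have "(\<lambda>d. step j (iter (Suc j) d p)) \<longlonglongrightarrow> step j L"
        using continuous_on_tendsto_compose[OF continuous_step[of UNIV j]] by simp
      then have "(\<lambda>d. iter j (Suc d) p) \<longlonglongrightarrow> step j L" by simp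
      then have "(\<lambda>d. iter j d p) \<longlonglongrightarrow> step j L" by (subst (asm) filterlim_sequentially_Suc)
      then show ?case by (rule convergentI)
    qed
  next
    case False
    then have "p \<in> quadrant (real m + 5)" using N by (intro quadrant_mono[OF N]) simp
    then show ?thesis using tendsto_uniform_limitI[OF uniform_limit_iter] convergentI by blast
  qed
  then show ?thesis by (simp add: limmap_def convergent_LIMSEQ_iff)
qed

lemma limmap_step: "limmap m p = step m (limmap (Suc m) p)"
proof (rule LIMSEQ_unique)
  show "(\<lambda>d. iter m (Suc d) p) \<longlonglongrightarrow> limmap m p"
    using iter_tendsto by (subst filterlim_sequentially_Suc)
  show "(\<lambda>d. iter m (Suc d) p) \<longlonglongrightarrow> step m (limmap (Suc m) p)"
    using continuous_on_tendsto_compose[OF continuous_step[of UNIV m] iter_tendsto] by simp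
qed

lemma limmap_displacement:
  assumes "p \<in> quadrant (real m + 6)"
  shows "norm (limmap m p - p) \<le> 4 * tol m"
  by (rule LIMSEQ_le_const2[OF tendsto_norm[OF tendsto_diff[OF iter_tendsto tendsto_const]]])
    (use iter_displacement[OF assms] in blast)

lemma tol_tendsto: "tol \<longlonglongrightarrow> 0"
  unfolding tol_def by real_asymp

lemma limmap_tendsto_id: "(\<lambda>m. limmap m p) \<longlonglongrightarrow> p"
proof -
  obtain N where N: "p \<in> quadrant (real N)" using exists_quadrant by blast
  have "(\<lambda>m. limmap m p - p) \<longlonglongrightarrow> 0"
  proof (rule Lim_null_comparison)
    show "\<forall>\<^sub>F m in sequentially. norm (limmap m p - p) \<le> 4 * tol m"
      using eventually_ge_at_top[of N]
      by eventually_elim (rule limmap_displacement, rule quadrant_mono[OF N], simp)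
    show "(\<lambda>m. 4 * tol m) \<longlonglongrightarrow> 0" using tendsto_mult_right_zero[OF tol_tendsto] by simp
  qed
  then show ?thesis by (simp add: LIM_zero_iff)
qed

text \<open>The value of \<open>limmap 0\<close> determines that of every \<open>limmap m\<close>, because the steps are invertible, and
\<open>limmap m\<close> tends to the identity.\<close>

lemma inj_limmap: "inj (limmap 0)"
proof (rule injI)
  fix p q assume eq: "limmap 0 p = limmap 0 q"
  have "limmap m p = limmap m q" for m
  proof (induction m)
    case (Suc m)
    then have "step_inv m (step m (limmap (Suc m) p)) = step_inv m (step m (limmap (Suc m) q))"
      by (simp flip: limmap_step)
    then show ?case by (simp add: step_inv_step)
  qed (rule eq)
  then have "(\<lambda>m. limmap m p) \<longlonglongrightarrow> q" using limmap_tendsto_id[of q] by simp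
  then show "p = q" using limmap_tendsto_id LIMSEQ_unique by blast
qed

text \<open>The inverse steps hardly move points of a right quadrant, so the backward orbit of \<open>q\<close> converges. Its
limit is the preimage: the compositions are uniformly Lipschitz and map the \<open>n\<close>-th point of the
orbit exactly to \<open>q\<close>.\<close>

lemma limmap_covers:
  assumes q: "q \<in> quadrant 1"
  obtains p where "limmap 0 p = q" "p \<in> quadrant 2"
proof -
  define r where "r = rec_nat q (\<lambda>n. step_inv n)"
  have r0: "r 0 = q" and rS: "r (Suc n) = step_inv n (r n)" for n by (simp_all add: r_def)
  have step_r: "step n (r (Suc n)) = r n" for n by (simp add: rS step_step_inv)
  have inv_near: "norm (step_inv n w - w) \<le> 2 * tol n" if w: "w \<in> quadrant 2" for n w
  proof -
    define v where "v = w - (0, push n (fst w))"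
    have "cmod (push n (fst w)) \<le> tol n"
      using w by (intro push_right(1)) (simp add: quadrant_def)
    then have 1: "norm (v - w) \<le> tol n" by (simp add: v_def norm_Pair)
    then have "norm (v - w) \<le> 1" using tol_le[of n] by simp
    from quadrant_perturb[OF w this] have "cmod (push n (snd v)) \<le> tol n"
      by (intro push_right(1)) (simp add: quadrant_def)
    then have 2: "norm (step_inv n w - v) \<le> tol n"
      by (simp add: step_inv_def Let_def norm_Pair flip: v_def)
    show ?thesis using 1 2 norm_triangle_ineq[of "step_inv n w - v" "v - w"] by simp
  qed
  have r_near: "norm (r n - q) + 4 * tol n \<le> 1 / 8" for n
  proof (induction n)
    case (Suc n)
    have "norm (r n - q) \<le> 1" using Suc tol_nonneg[of n] by linarith
    from quadrant_perturb[OF q this] have "norm (r (Suc n) - r n) \<le> 2 * tol n"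
      unfolding rS by (intro inv_near) simp
    then show ?case using Suc norm_triangle_ineq[of "r (Suc n) - r n" "r n - q"] by (simp add: tol_Suc)
  qed (simp add: r0 tol_def)
  have r2: "r n \<in> quadrant 2" for n
  proof -
    have "norm (r n - q) \<le> 1" using r_near[of n] tol_nonneg[of n] by linarith
    from quadrant_perturb[OF q this] show ?thesis by simp
  qed
  have "summable (\<lambda>n. r (Suc n) - r n)"
  proof (rule summable_comparison_test')
    show "summable (\<lambda>n. 2 * tol n)" unfolding tol_def by (intro summable_mult summable_divide summable_geometric) simp
    show "norm (r (Suc n) - r n) \<le> 2 * tol n" for n using inv_near[OF r2] by (simp add: rS)
  qed
  then have "convergent (\<lambda>n. r n)"
    by (subst (asm) summable_iff_convergent) (simp add: sum_lessThan_telescope convergent_diff_const_right_iff)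
  then obtain p where p: "r \<longlonglongrightarrow> p" by (auto simp: convergent_def)
  have p2: "p \<in> quadrant 2" using closed_sequentially[OF closed_quadrant _ p] r2 by blast
  have iter_r: "iter 0 n (r n) = q" for n
  proof (induction n)
    case (Suc n)
    then show ?case by (simp add: iter_Suc_right step_r del: iter.simps)
  qed (simp add: r0)
  have "(\<lambda>n. iter 0 n p - q) \<longlonglongrightarrow> 0"
  proof (rule Lim_null_comparison)
    show "\<forall>\<^sub>F n in sequentially. norm (iter 0 n p - q) \<le> 2 * norm (p - r n)"
    proof (intro always_eventually allI)
      fix n
      show "norm (iter 0 n p - q) \<le> 2 * norm (p - r n)"
        using iter_lipschitz[of p 0 "r n" n] p2 r2[of n] quadrant_mono[of _ 2 6] by (simp add: iter_r)
    qed
    have "(\<lambda>n. 2 * norm (p - r n)) \<longlonglongrightarrow> 2 * norm (p - p)"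
      by (intro tendsto_intros p)
    then show "(\<lambda>n. 2 * norm (p - r n)) \<longlonglongrightarrow> 0" by simp
  qed
  then have "(\<lambda>n. iter 0 n p) \<longlonglongrightarrow> q" by (simp add: LIM_zero_iff)
  then have "limmap 0 p = q" using iter_tendsto LIMSEQ_unique by blast
  with p2 show ?thesis using that by blast
qed

text \<open>The forbidden values, following their drift to the left under the inverse steps. The allowance
\<open>4 - 2 * tol n\<close> for the imaginary part grows by exactly the error \<open>tol n\<close> of one step.\<close>

definition left_region :: "nat \<Rightarrow> complex set" where
  "left_region n = {z. Re z \<le> - (9 * real n + 8008) \<and> \<bar>Im z\<bar> \<le> 4 - 2 * tol n}"

lemma push_left_region:
  assumes "z \<in> left_region n" "w \<in> left_region n"
  shows "w - push n z \<in> left_region (Suc n)"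
proof -
  have "cmod (push n z - 10) \<le> tol n"
    using assms(1) tol_nonneg[of n] by (intro push_left) (auto simp: left_region_def)
  then have "\<bar>Re (push n z) - 10\<bar> \<le> tol n" "\<bar>Im (push n z)\<bar> \<le> tol n"
    using abs_Re_le_cmod[of "push n z - 10"] abs_Im_le_cmod[of "push n z - 10"] by auto
  then show ?thesis using assms(2) tol_le[of n] by (auto simp: left_region_def tol_Suc)
qed

text \<open>If a forbidden value were attained at \<open>p\<close>, the points \<open>limmap m p\<close> would drift to infinity on the left; but
they converge to \<open>p\<close>.\<close>

lemma limmap_avoids:
  assumes "fst (limmap 0 p) \<in> left_region 0" "snd (limmap 0 p) \<in> left_region 0"
  shows False
proof -
  have "fst (limmap m p) \<in> left_region m \<and> snd (limmap m p) \<in> left_region m" for m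
  proof (induction m)
    case (Suc m)
    define x y where "x = fst (limmap (Suc m) p)" and "y = snd (limmap (Suc m) p)"
    define x' y' where "x' = fst (limmap m p)" and "y' = snd (limmap m p)"
    have xy: "x' = x + push m y" "y' = y + push m x'"
      using limmap_step[of m p] by (simp_all add: x_def y_def x'_def y'_def step_def xshear_def yshear_def)
    have x': "x' \<in> left_region m" and y': "y' \<in> left_region m" using Suc by (auto simp: x'_def y'_def)
    have y: "y \<in> left_region (Suc m)" using push_left_region[OF x' y'] xy by simp
    have "cmod (push m y - 10) \<le> tol m"
      using y tol_nonneg[of "Suc m"] by (intro push_left) (auto simp: left_region_def)
    then have "\<bar>Re (push m y) - 10\<bar> \<le> tol m" "\<bar>Im (push m y)\<bar> \<le> tol m"
      using abs_Re_le_cmod[of "push m y - 10"] abs_Im_le_cmod[of "push m y - 10"] by auto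
    then have "x \<in> left_region (Suc m)"
      using x' xy tol_le[of m] by (auto simp: left_region_def tol_Suc)
    with y show ?case by (simp add: x_def y_def)
  qed (use assms in auto)
  then have Re: "Re (fst (limmap m p)) \<le> - real m" for m by (simp add: left_region_def) (smt (verit) of_nat_0_le_iff)
  obtain N where N: "p \<in> quadrant (real N)" using exists_quadrant by blast
  have "norm (limmap (N + 2) p - p) \<le> 1"
    using limmap_displacement[of p "N + 2"] quadrant_mono[OF N, of "real (N + 2) + 6"] tol_le[of "N + 2"] by simp
  from quadrant_perturb[OF N this] Re[of "N + 2"] show False by (simp add: quadrant_def)
qed

section \<open>Regularity of the limit map\<close>

lemma step_holomorphic:
  assumes "a holomorphic_on S" "b holomorphic_on S"
  shows "(\<lambda>t. fst (step n (a t, b t))) holomorphic_on S"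
    and "(\<lambda>t. snd (step n (a t, b t))) holomorphic_on S"
  using assms by (auto simp: step_def xshear_def yshear_def intro!: holomorphic_intros)

lemma iter_holomorphic:
  assumes "a holomorphic_on S" "b holomorphic_on S"
  shows "(\<lambda>t. fst (iter m d (a t, b t))) holomorphic_on S \<and> (\<lambda>t. snd (iter m d (a t, b t))) holomorphic_on S"
proof (induction d arbitrary: m)
  case (Suc d)
  from step_holomorphic[OF conjunct1[OF Suc[of "Suc m"]] conjunct2[OF Suc[of "Suc m"]], of m] show ?case by simp
qed (use assms in simp)

definition open_quadrant :: "real \<Rightarrow> plane set" where
  "open_quadrant r = {p. Re (fst p) > - r \<and> Re (snd p) > - r}"

lemma open_quadrant: "open (open_quadrant r)"
  unfolding open_quadrant_def by (intro open_Collect_conj open_Collect_less continuous_intros)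

lemma open_quadrant_subset: "open_quadrant r \<subseteq> quadrant r"
  by (auto simp: quadrant_def open_quadrant_def)

lemma UN_open_quadrant: "(\<Union>N. open_quadrant (real N + 5)) = UNIV"
proof -
  have "\<exists>N. p \<in> open_quadrant (real N + 5)" for p
  proof -
    obtain N where "p \<in> quadrant (real N)" using exists_quadrant by blast
    then have "p \<in> open_quadrant (real N + 5)" by (simp add: quadrant_def open_quadrant_def)
    then show ?thesis by blast
  qed
  then show ?thesis by auto
qed

lemma continuous_limmap: "continuous_on UNIV (limmap 0)"
proof -
  have "continuous_on (open_quadrant (real N + 5)) (limmap 0)" for N
  proof -
    have "continuous_on (open_quadrant (real N + 5)) (limmap m)" if "m \<le> N" for m
      using that
    proof (induction rule: inc_induct)
      case base
      have "uniform_limit (open_quadrant (real N + 5)) (iter N) (limmap N) sequentially"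
        using uniform_limit_iter open_quadrant_subset by (rule uniform_limit_on_subset)
      then show ?case
        by (rule uniform_limit_theorem[rotated]) (simp_all add: continuous_iter)
    next
      case (step j)
      have "continuous_on (open_quadrant (real N + 5)) (\<lambda>p. step j (limmap (Suc j) p))"
        using continuous_on_compose[OF step.IH continuous_step] by (simp add: comp_def)
      then show ?case by (simp flip: limmap_step)
    qed
    then show ?thesis by blast
  qed
  then have "continuous_on (\<Union>N. open_quadrant (real N + 5)) (limmap 0)"
    by (intro continuous_on_open_UN open_quadrant)
  then show ?thesis by (simp only: UN_open_quadrant)
qed

text \<open>Holomorphy is stated along arbitrary holomorphic curves. In this form it passes through compositions
directly, whereas separate holomorphy does not.\<close>

lemma limmap_holomorphic:
  assumes a: "a holomorphic_on UNIV" and b: "b holomorphic_on UNIV"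
  shows "(\<lambda>t. fst (limmap 0 (a t, b t))) holomorphic_on UNIV"
    and "(\<lambda>t. snd (limmap 0 (a t, b t))) holomorphic_on UNIV"
proof -
  define S where "S N = (\<lambda>t. (a t, b t)) -` open_quadrant (real N + 5)" for N :: nat
  have cont: "continuous_on UNIV (\<lambda>t. (a t, b t))"
    using a b by (intro continuous_on_Pair holomorphic_on_imp_continuous_on)
  have op: "open (S N)" for N
    unfolding S_def using cont open_quadrant by (rule open_vimage[rotated])
  \<comment> \<open>On \<open>S N\<close> the curve stays where \<open>iter N\<close> converges uniformly; the remaining steps are finitely many.\<close>
  have *: "(\<lambda>t. fst (limmap m (a t, b t))) holomorphic_on S N \<and>
        (\<lambda>t. snd (limmap m (a t, b t))) holomorphic_on S N" if "m \<le> N" for m N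
    using that
  proof (induction rule: inc_induct)
    case base
    have aS: "a holomorphic_on S N" "b holomorphic_on S N"
      using a b by (auto elim: holomorphic_on_subset)
    have ul: "uniform_limit K (\<lambda>d t. iter N d (a t, b t)) (\<lambda>t. limmap N (a t, b t)) sequentially"
      if "K \<subseteq> S N" for K
    proof (rule uniform_limit_compose'[OF uniform_limit_iter])
      show "(\<lambda>t. (a t, b t)) \<in> K \<rightarrow> quadrant (real N + 5)"
        using that open_quadrant_subset by (auto simp: S_def)
    qed
    show ?case
    proof
      show "(\<lambda>t. fst (limmap N (a t, b t))) holomorphic_on S N"
      proof (rule holomorphic_uniform_sequence[OF op])
        show "(\<lambda>t. fst (iter N d (a t, b t))) holomorphic_on S N" for d
          using iter_holomorphic[OF aS] by blast
        fix t assume "t \<in> S N"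
        then obtain e where "e > 0" "cball t e \<subseteq> S N" using op open_contains_cball by blast
        then show "\<exists>e>0. cball t e \<subseteq> S N \<and>
           uniform_limit (cball t e) (\<lambda>d t. fst (iter N d (a t, b t))) (\<lambda>t. fst (limmap N (a t, b t))) sequentially"
          using bounded_linear.uniform_limit[OF bounded_linear_fst ul] by blast
      qed
      show "(\<lambda>t. snd (limmap N (a t, b t))) holomorphic_on S N"
      proof (rule holomorphic_uniform_sequence[OF op])
        show "(\<lambda>t. snd (iter N d (a t, b t))) holomorphic_on S N" for d
          using iter_holomorphic[OF aS] by blast
        fix t assume "t \<in> S N"
        then obtain e where "e > 0" "cball t e \<subseteq> S N" using op open_contains_cball by blast
        then show "\<exists>e>0. cball t e \<subseteq> S N \<and>
           uniform_limit (cball t e) (\<lambda>d t. snd (iter N d (a t, b t))) (\<lambda>t. snd (limmap N (a t, b t))) sequentially"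
          using bounded_linear.uniform_limit[OF bounded_linear_snd ul] by blast
      qed
    qed
  next
    case (step j)
    from step_holomorphic[OF conjunct1[OF step.IH] conjunct2[OF step.IH], of j] show ?case
      by (simp flip: limmap_step)
  qed
  have UN: "(\<Union>N. S N) = UNIV" using UN_open_quadrant by (force simp: S_def)
  have "(\<lambda>t. fst (limmap 0 (a t, b t))) holomorphic_on (\<Union>N. S N)"
    by (intro holomorphic_on_UN_open op conjunct1[OF *]) simp
  then show "(\<lambda>t. fst (limmap 0 (a t, b t))) holomorphic_on UNIV" by (simp only: UN)
  have "(\<lambda>t. snd (limmap 0 (a t, b t))) holomorphic_on (\<Union>N. S N)"
    by (intro holomorphic_on_UN_open op conjunct2[OF *]) simp
  then show "(\<lambda>t. snd (limmap 0 (a t, b t))) holomorphic_on UNIV" by (simp only: UN)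
qed

lemma deriv_small_if_bounded:
  assumes "f holomorphic_on UNIV" and "\<And>t. cmod (t - c) \<le> 1 \<Longrightarrow> cmod (f t) \<le> 1 / 8"
  shows "cmod (deriv f c) \<le> 1 / 8"
proof -
  have "cmod ((deriv ^^ 1) f c) \<le> fact 1 * (1 / 8) / 1 ^ 1"
    using assms by (intro Cauchy_inequality)
      (auto simp: norm_minus_commute intro: holomorphic_on_subset holomorphic_on_imp_continuous_on)
  then show ?thesis by simp
qed

text \<open>On the unit ball around \<open>p\<close> the map differs from the identity by at most 1/8, so Cauchy's estimate bounds
the difference of the derivatives.\<close>

lemma limmap_partials:
  assumes p: "p \<in> quadrant 2"
  shows "cmod (deriv (\<lambda>t. fst (limmap 0 (t, snd p))) (fst p) - 1) \<le> 1 / 8"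
    and "cmod (deriv (\<lambda>t. fst (limmap 0 (fst p, t))) (snd p)) \<le> 1 / 8"
    and "cmod (deriv (\<lambda>t. snd (limmap 0 (t, snd p))) (fst p)) \<le> 1 / 8"
    and "cmod (deriv (\<lambda>t. snd (limmap 0 (fst p, t))) (snd p) - 1) \<le> 1 / 8"
proof -
  have near: "cmod (fst (limmap 0 q) - fst q) \<le> 1 / 8" "cmod (snd (limmap 0 q) - snd q) \<le> 1 / 8"
    if "norm (q - p) \<le> 1" for q
  proof -
    have "q \<in> quadrant (real 0 + 6)"
      using quadrant_perturb[OF p that] by (rule quadrant_mono) simp
    then have "norm (limmap 0 q - q) \<le> 1 / 8"
      using limmap_displacement[of q 0] by (simp add: tol_def)
    then show "cmod (fst (limmap 0 q) - fst q) \<le> 1 / 8" "cmod (snd (limmap 0 q) - snd q) \<le> 1 / 8"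
      using norm_fst_plane[of "limmap 0 q - q"] norm_snd_plane[of "limmap 0 q - q"] by auto
  qed
  have n1: "norm ((t, snd p) - p) = cmod (t - fst p)" for t by (cases p) (simp add: norm_Pair)
  have n2: "norm ((fst p, t) - p) = cmod (t - snd p)" for t by (cases p) (simp add: norm_Pair)
  have h: "(\<lambda>t. fst (limmap 0 (t, snd p))) holomorphic_on UNIV"
    "(\<lambda>t. fst (limmap 0 (fst p, t))) holomorphic_on UNIV"
    "(\<lambda>t. snd (limmap 0 (t, snd p))) holomorphic_on UNIV"
    "(\<lambda>t. snd (limmap 0 (fst p, t))) holomorphic_on UNIV"
    by (intro limmap_holomorphic holomorphic_intros)+
  have diff: "f holomorphic_on UNIV \<Longrightarrow> f field_differentiable (at c)" for f :: "complex \<Rightarrow> complex" and c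
    by (simp add: holomorphic_on_def)
  have "cmod (deriv (\<lambda>t. fst (limmap 0 (t, snd p)) - t) (fst p)) \<le> 1 / 8"
    using near(1)[of "(_, snd p)"] n1 h by (intro deriv_small_if_bounded holomorphic_intros) auto
  then show "cmod (deriv (\<lambda>t. fst (limmap 0 (t, snd p))) (fst p) - 1) \<le> 1 / 8"
    using diff[OF h(1)] by simp
  have "cmod (deriv (\<lambda>t. snd (limmap 0 (fst p, t)) - t) (snd p)) \<le> 1 / 8"
    using near(2)[of "(fst p, _)"] n2 h by (intro deriv_small_if_bounded holomorphic_intros) auto
  then show "cmod (deriv (\<lambda>t. snd (limmap 0 (fst p, t))) (snd p) - 1) \<le> 1 / 8"
    using diff[OF h(4)] by simp
  have "cmod (deriv (\<lambda>t. fst (limmap 0 (fst p, t)) - fst p) (snd p)) \<le> 1 / 8"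
    using near(1)[of "(fst p, _)"] n2 h by (intro deriv_small_if_bounded holomorphic_intros) auto
  then show "cmod (deriv (\<lambda>t. fst (limmap 0 (fst p, t))) (snd p)) \<le> 1 / 8"
    using diff[OF h(2)] by simp
  have "cmod (deriv (\<lambda>t. snd (limmap 0 (t, snd p)) - snd p) (fst p)) \<le> 1 / 8"
    using near(2)[of "(_, snd p)"] n1 h by (intro deriv_small_if_bounded holomorphic_intros) auto
  then show "cmod (deriv (\<lambda>t. snd (limmap 0 (t, snd p))) (fst p)) \<le> 1 / 8"
    using diff[OF h(3)] by simp
qed

lemma near_identity_2x2_kernel:
  fixes a b c d x y :: complex
  assumes "cmod (a - 1) \<le> 1 / 8" "cmod b \<le> 1 / 8" "cmod c \<le> 1 / 8" "cmod (d - 1) \<le> 1 / 8"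
    and "a * x + b * y = 0" "c * x + d * y = 0"
  shows "x = 0" "y = 0"
proof -
  have "x = (1 - a) * x - b * y" "y = (1 - d) * y - c * x"
    using assms(5,6) by (simp_all add: algebra_simps add_eq_0_iff)
  then have "cmod x \<le> cmod (1 - a) * cmod x + cmod b * cmod y"
    "cmod y \<le> cmod (1 - d) * cmod y + cmod c * cmod x"
    by (metis norm_triangle_ineq4 norm_mult)+
  moreover have "cmod (1 - a) * cmod x \<le> 1 / 8 * cmod x" "cmod b * cmod y \<le> 1 / 8 * cmod y"
    "cmod (1 - d) * cmod y \<le> 1 / 8 * cmod y" "cmod c * cmod x \<le> 1 / 8 * cmod x"
    using assms by (intro mult_right_mono; simp add: norm_minus_commute)+
  ultimately have "cmod x + cmod y \<le> 0" using norm_ge_zero[of x] norm_ge_zero[of y] by linarith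
  then show "x = 0" "y = 0" using norm_ge_zero[of x] norm_ge_zero[of y]
    by (auto simp: add_nonneg_eq_0_iff dest: antisym)
qed

section \<open>Choice of roots\<close>

text \<open>Multiplying a fourth root \<open>y\<close> by \<open>\<i>\<close> rotates \<open>w ^ j * y\<close> by a right angle, and one of the four rotated
values lies within 45 degrees of the positive real axis. Since \<open>w ^ j * y = y ^ (4 * j + 1)\<close>, this
controls the argument of an arbitrarily high power of \<open>y\<close>.\<close>

lemma fourth_root_near_real_power:
  obtains y :: complex where "y ^ 4 = w" "Re (w ^ j * y) \<ge> cmod (w ^ j * y) / 2"
proof -
  obtain y0 :: complex where y0: "y0 ^ 4 = w"
    by (metis zero_neq_numeral exists_complex_root)
  define z where "z = w ^ j * y0"
  have z: "cmod z \<le> \<bar>Re z\<bar> + \<bar>Im z\<bar>" by (rule cmod_le)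
  have i4: "(\<i> * y0) ^ 4 = w" "(- \<i> * y0) ^ 4 = w" "(- y0) ^ 4 = w"
    using y0 by (simp_all add: power_mult_distrib)
  consider "Re z \<ge> \<bar>Im z\<bar>" | "- Re z \<ge> \<bar>Im z\<bar>" | "Im z \<ge> \<bar>Re z\<bar>" | "- Im z \<ge> \<bar>Re z\<bar>"
    by linarith
  then show ?thesis
  proof cases
    case 1
    with z show ?thesis by (intro that[OF y0]) (simp flip: z_def)
  next
    case 2
    with z show ?thesis by (intro that[OF i4(3)]) (simp flip: z_def)
  next
    case 3
    have "w ^ j * (- \<i> * y0) = - (\<i> * z)" by (simp add: z_def)
    then have "Re (w ^ j * (- \<i> * y0)) = Im z" "cmod (w ^ j * (- \<i> * y0)) = cmod z"
      by (simp_all only: norm_minus_cancel norm_mult norm_ii mult_1 uminus_complex.sel Re_i_times minus_minus)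
    with z 3 show ?thesis by (intro that[OF i4(2)]) linarith
  next
    case 4
    have "w ^ j * (\<i> * y0) = \<i> * z" by (simp add: z_def)
    then have "Re (w ^ j * (\<i> * y0)) = - Im z" "cmod (w ^ j * (\<i> * y0)) = cmod z"
      by (simp_all only: norm_mult norm_ii mult_1 Re_i_times)
    with z 4 show ?thesis by (intro that[OF i4(1)]) linarith
  qed
qed

text \<open>Take the fourth root \<open>y\<close> given by the previous lemma and then the principal \<open>b\<close>-th root of \<open>y\<close>. The
second root provides the narrow sector, and the choice of the first survives because
\<open>v ^ (4 * b * j + b) = y ^ (4 * j + 1)\<close>.\<close>

lemma root_in_sector_with_near_real_power:
  assumes "b > 0"
  obtains v :: complex where "v ^ (4 * b) = w" "Re v \<ge> cmod v * cos (pi / b)"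
    "Re (v ^ (4 * b * j + b)) \<ge> cmod v ^ (4 * b * j + b) / 2"
proof -
  obtain y :: complex where y: "y ^ 4 = w" "Re (w ^ j * y) \<ge> cmod (w ^ j * y) / 2"
    by (rule fourth_root_near_real_power)
  obtain v where v: "v ^ b = y" "Re v \<ge> cmod v * cos (pi / b)"
  proof (cases "y = 0")
    case True
    with assms show ?thesis by (intro that[of 0]) auto
  next
    case False
    define v where "v = exp (Ln y / of_nat b)"
    have "v ^ b = exp (of_nat b * (Ln y / of_nat b))" by (simp only: v_def exp_of_nat_mult)
    then have "v ^ b = y" using assms False by simp
    moreover have "Re v \<ge> cmod v * cos (pi / b)"
    proof -
      have "\<bar>Im (Ln y)\<bar> \<le> pi" using mpi_less_Im_Ln[OF False] Im_Ln_le_pi[OF False] by simp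
      then have "cos (pi / b) \<le> cos \<bar>Im (Ln y) / b\<bar>"
        using assms by (intro cos_monotone_0_pi_le) (auto simp: field_simps)
      then have "cos (pi / b) \<le> cos (Im (Ln y) / b)" by (simp only: cos_abs_real)
      then show ?thesis by (simp add: v_def Re_exp)
    qed
    ultimately show ?thesis by (rule that)
  qed
  have pow: "v ^ (4 * b * j + b) = w ^ j * y"
  proof -
    have "v ^ (4 * b * j + b) = (v ^ b) ^ (4 * j) * v ^ b"
      by (simp add: power_add mult_ac flip: power_mult)
    then show ?thesis by (simp add: v(1) power_mult y(1))
  qed
  have "v ^ (4 * b) = w" using v(1) y(1) by (metis mult.commute power_mult)
  moreover have "cmod v ^ (4 * b * j + b) = cmod (w ^ j * y)" by (simp only: norm_power flip: pow)
  ultimately show ?thesis using that[of v] v(2) y(2) pow by simp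
qed

text \<open>The modulus of an \<open>n\<close>-th root exceeds 1 only by about \<open>\<epsilon> / n\<close>, but a sector of half-angle \<open>pi / b\<close> with
\<open>n = 4 * b\<close> loses only a quantity of order \<open>1 / n ^ 2\<close> when passing from the modulus to the real part.\<close>

lemma exists_narrow_sector:
  assumes "\<epsilon> > (0::real)"
  obtains b :: nat where "b \<ge> 2" "(1 + \<epsilon>) * cos (pi / b) ^ (4 * b) > 1"
proof -
  have "(\<lambda>b::nat. cos (pi / b) ^ (4 * b)) \<longlonglongrightarrow> 1" by real_asymp
  then have "(\<lambda>b::nat. (1 + \<epsilon>) * cos (pi / b) ^ (4 * b)) \<longlonglongrightarrow> (1 + \<epsilon>) * 1"
    by (intro tendsto_intros)
  then have "\<forall>\<^sub>F b in sequentially. (1 + \<epsilon>) * cos (pi / real b) ^ (4 * b) > 1"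
    using assms by (intro order_tendstoD(1)) auto
  then have "\<forall>\<^sub>F b in sequentially. b \<ge> 2 \<and> (1 + \<epsilon>) * cos (pi / real b) ^ (4 * b) > 1"
    using eventually_ge_at_top[of 2] by eventually_elim simp
  then show ?thesis using that eventually_happens' trivial_limit_sequentially by blast
qed

lemma card_nth_roots_le:
  assumes "n > 0"
  shows "finite {v :: complex. v ^ n = c} \<and> card {v. v ^ n = c} \<le> n"
proof (cases "c = 0")
  case True
  then have "{v :: complex. v ^ n = c} = {0}" using assms by auto
  then show ?thesis using assms by simp
next
  case False
  then show ?thesis using assms finite_nth_roots card_nth_roots by (metis le_refl)
qed

section \<open>The covering map\<close>

lemma topspace_complex_space: "topspace (complex_space k) = {..<k} \<rightarrow>\<^sub>E UNIV"
  by (simp add: complex_space_def)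

lemma closure_polydisc_subset:
  "complex_space k closure_of polydisc k 1 \<subseteq> {z. \<forall>j<k. cmod (z j) \<le> 1}"
proof -
  have "closedin (complex_space k) (Pi\<^sub>E {..<k} (\<lambda>_. cball 0 1))"
    unfolding complex_space_def by (subst closedin_product_topology) auto
  moreover have "polydisc k 1 \<subseteq> Pi\<^sub>E {..<k} (\<lambda>_. cball 0 1)"
    by (rule subsetI) (simp add: polydisc_def topspace_complex_space PiE_iff less_imp_le)
  ultimately have "complex_space k closure_of polydisc k 1 \<subseteq> Pi\<^sub>E {..<k} (\<lambda>_. cball 0 1)"
    by (rule closure_of_minimal[rotated])
  then show ?thesis by (auto simp: PiE_iff)
qed

text \<open>The composition described at the beginning, for arbitrary values of its parameters. The inequalities that
make the two cutoffs effective are hypotheses of the lemmas on the range.\<close>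

locale covering_map =
  fixes k n m q :: nat and a A M :: real
  assumes k: "k \<ge> 3" and n: "n > 0"
begin

definition bump :: "(nat \<Rightarrow> complex) \<Rightarrow> complex" where
  "bump z = exp (- (of_real A * z (k - 1) ^ q))"

text \<open>The coordinates other than the last after applying first \<open>limmap 0\<close> and then the shear by \<open>bump\<close>. The
shift by \<open>- 8011\<close> takes the disc of radius 2 around 0 into \<open>left_region 0\<close>.\<close>

definition base :: "(nat \<Rightarrow> complex) \<Rightarrow> nat \<Rightarrow> complex" where
  "base z i = (if i = 0 then fst (limmap 0 (z 0, z 1)) + 8011 * bump z
    else if i = 1 then snd (limmap 0 (z 0, z 1)) + 8011 * bump z else z i)"

definition cutoff :: "(nat \<Rightarrow> complex) \<Rightarrow> complex" where
  "cutoff v = exp (- (of_real a * (\<Sum>i<k - 1. v i ^ m)))"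

text \<open>The point to which the powers are applied last: \<open>root_map z i\<close> is an \<open>n\<close>-th root of \<open>G z i\<close>.\<close>

definition root_map :: "(nat \<Rightarrow> complex) \<Rightarrow> nat \<Rightarrow> complex" where
  "root_map z i = (if i = k - 1 then z i ^ 4 - of_real M * (1 - cutoff (base z)) else base z i)"

definition G :: "(nat \<Rightarrow> complex) \<Rightarrow> nat \<Rightarrow> complex" where
  "G z = (\<lambda>i\<in>{..<k}. root_map z i ^ n)"

lemma idx: "0 < k" "k - 1 < k" "k - 1 \<noteq> 0" "k - 1 \<noteq> 1" "1 < k" "0 < k - 1" "1 < k - 1" "Suc 0 < k"
  using k by auto

lemma G_apply: "i < k \<Longrightarrow> G z i = root_map z i ^ n"
  by (simp add: G_def)

lemma base_holomorphic:
  assumes "\<And>i. i < k \<Longrightarrow> (\<lambda>t. \<gamma> t i) holomorphic_on UNIV" "i < k"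
  shows "(\<lambda>t. base (\<gamma> t) i) holomorphic_on UNIV"
proof -
  have "(\<lambda>t. bump (\<gamma> t)) holomorphic_on UNIV"
    unfolding bump_def by (intro holomorphic_intros assms idx)
  note intros = holomorphic_intros this limmap_holomorphic assms idx
  consider "i = 0" | "i = 1" | "i \<noteq> 0" "i \<noteq> 1" by blast
  then show ?thesis
  proof cases
    case 1
    have "(\<lambda>t. fst (limmap 0 (\<gamma> t 0, \<gamma> t 1)) + 8011 * bump (\<gamma> t)) holomorphic_on UNIV"
      by (intro intros)
    then show ?thesis using 1 by (simp add: base_def)
  next
    case 2
    have "(\<lambda>t. snd (limmap 0 (\<gamma> t 0, \<gamma> t 1)) + 8011 * bump (\<gamma> t)) holomorphic_on UNIV"
      by (intro intros)
    then show ?thesis using 2 by (simp add: base_def)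
  next
    case 3
    then show ?thesis using assms by (simp add: base_def)
  qed
qed

lemma root_map_holomorphic:
  assumes "\<And>i. i < k \<Longrightarrow> (\<lambda>t. \<gamma> t i) holomorphic_on UNIV" "i < k"
  shows "(\<lambda>t. root_map (\<gamma> t) i) holomorphic_on UNIV"
proof (cases "i = k - 1")
  case True
  have "(\<lambda>t. cutoff (base (\<gamma> t))) holomorphic_on UNIV"
    unfolding cutoff_def by (intro holomorphic_intros base_holomorphic assms) auto
  then show ?thesis
    unfolding root_map_def using True assms by (auto intro!: holomorphic_intros)
next
  case False
  then show ?thesis using base_holomorphic[OF assms] by (simp add: root_map_def)
qed

lemma fun_upd_holomorphic: "(\<lambda>t. (z(j := t)) i) holomorphic_on UNIV"
  for z :: "nat \<Rightarrow> complex"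
  by (cases "i = j") auto

lemma continuous_map_G: "continuous_map (complex_space k) (complex_space k) G"
proof -
  have "((\<lambda>z. G z i) \<longlongrightarrow> G x i) (atin (complex_space k) x)"
    if x: "x \<in> topspace (complex_space k)" and i: "i < k" for x i
  proof -
    have "continuous_map (complex_space k) euclidean (\<lambda>z. z j)" if "j < k" for j
      unfolding complex_space_def using that
      by (metis continuous_map_product_projection lessThan_iff)
    then have proj: "((\<lambda>z. z j) \<longlongrightarrow> x j) (atin (complex_space k) x)" if "j < k" for j
      using that x by (auto simp: continuous_map_atin limitin_canonical_iff)
    have bump: "(bump \<longlongrightarrow> bump x) (atin (complex_space k) x)"
      unfolding bump_def by (intro tendsto_intros proj idx)
    have lim: "((\<lambda>z. limmap 0 (z 0, z 1)) \<longlongrightarrow> limmap 0 (x 0, x 1)) (atin (complex_space k) x)"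
      by (rule continuous_on_tendsto_compose[OF continuous_limmap]) (auto intro!: tendsto_intros proj idx)
    have base: "((\<lambda>z. base z j) \<longlongrightarrow> base x j) (atin (complex_space k) x)" if "j < k" for j
      unfolding base_def using that by (auto intro!: tendsto_intros lim lim[simplified] bump proj)
    have "((\<lambda>z. root_map z i) \<longlongrightarrow> root_map x i) (atin (complex_space k) x)"
      unfolding root_map_def cutoff_def using i by (auto intro!: tendsto_intros base proj)
    then show ?thesis using i by (auto simp: G_def intro!: tendsto_intros)
  qed
  then have "continuous_map (complex_space k) euclidean (\<lambda>z. G z i)" if "i < k" for i
    using that by (auto simp: continuous_map_atin limitin_canonical_iff)
  then show ?thesis
    unfolding complex_space_def by (auto simp: continuous_map_componentwise G_def)
qed

lemma entire_map_G: "entire_map k G"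
  unfolding entire_map_def
proof (intro conjI ballI allI impI continuous_map_G)
  fix z and i j assume "i < k" "j < k"
  then show "(\<lambda>t. G (z(j := t)) i) holomorphic_on UNIV"
    unfolding G_def by (simp, intro holomorphic_intros root_map_holomorphic fun_upd_holomorphic)
qed

text \<open>A point is determined by its values \<open>root_map z\<close> and its last coordinate \<open>y\<close>: these determine \<open>bump z\<close>, hence
the values of \<open>limmap 0\<close>, which is injective. There are at most \<open>n ^ k\<close> possibilities for \<open>root_map z\<close>, and
for each of them \<open>y ^ 4\<close> is known.\<close>

lemma fibre_bound:
  assumes "w \<in> G ` topspace (complex_space k)"
  defines "S \<equiv> {z \<in> topspace (complex_space k). G z = w}"
  shows "finite S \<and> card S \<le> (4 * n) ^ k"
proof -
  define R where "R = Pi\<^sub>E {..<k} (\<lambda>i. {v :: complex. v ^ n = w i})"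
  define u where "u v = v (k - 1) + of_real M * (1 - cutoff v)" for v :: "nat \<Rightarrow> complex"
  define T where "T = (SIGMA v:R. {y :: complex. y ^ 4 = u v})"
  define f where "f z = (restrict (root_map z) {..<k}, z (k - 1))" for z
  note roots = card_nth_roots_le[OF n] card_nth_roots_le[of 4, simplified]
  have finR: "finite R" unfolding R_def using roots by (auto intro: finite_PiE)
  have "card R = (\<Prod>i<k. card {v. v ^ n = w i})" by (simp add: R_def card_PiE)
  also have "\<dots> \<le> (\<Prod>i<k. n)" using roots by (intro prod_mono) auto
  finally have cardR: "card R \<le> n ^ k" by simp
  have finT: "finite T" unfolding T_def using finR roots by auto
  have "card T = (\<Sum>v\<in>R. card {y. y ^ 4 = u v})"
    unfolding T_def using finR roots by (intro card_SigmaI) auto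
  also have "\<dots> \<le> (\<Sum>v\<in>R. 4)" using roots by (intro sum_mono) auto
  also have "\<dots> \<le> n ^ k * 4 ^ 1" using cardR by simp
  also have "\<dots> \<le> n ^ k * 4 ^ k" using k by (intro mult_left_mono power_increasing) auto
  finally have cardT: "card T \<le> (4 * n) ^ k" by (simp add: power_mult_distrib mult.commute)
  have base_eq: "base z i = restrict (root_map z) {..<k} i" if "i < k - 1" for z i
  proof -
    have "i < k" using that by simp
    with that show ?thesis by (simp add: root_map_def)
  qed
  have cutoff_eq: "cutoff (base z) = cutoff (restrict (root_map z) {..<k})" for z
    using base_eq by (simp add: cutoff_def)
  have sub: "f ` S \<subseteq> T"
  proof
    fix p assume "p \<in> f ` S"
    then obtain z where z: "z \<in> S" "p = f z" by blast
    have "restrict (root_map z) {..<k} \<in> R"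
      using z by (auto simp: R_def S_def G_def)
    moreover have "z (k - 1) ^ 4 = u (restrict (root_map z) {..<k})"
      using idx by (simp add: u_def flip: cutoff_eq) (simp add: root_map_def)
    ultimately show "p \<in> T" using z by (simp add: T_def f_def)
  qed
  have "inj_on f S"
  proof (rule inj_onI)
    fix z z' assume z: "z \<in> S" "z' \<in> S" and eq: "f z = f z'"
    have last: "z (k - 1) = z' (k - 1)" using eq by (simp add: f_def)
    have b: "base z i = base z' i" if "i < k - 1" for i
    proof -
      have "restrict (root_map z) {..<k} = restrict (root_map z') {..<k}" using eq by (simp add: f_def)
      then show ?thesis by (simp only: base_eq[OF that])
    qed
    have "bump z = bump z'" using last by (simp add: bump_def)
    then have "limmap 0 (z 0, z 1) = limmap 0 (z' 0, z' 1)"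
      using b[of 0] b[of 1] idx by (simp add: base_def prod_eq_iff)
    then have "(z 0, z 1) = (z' 0, z' 1)" by (rule injD[OF inj_limmap])
    then have 01: "z 0 = z' 0" "z 1 = z' 1" by auto
    show "z = z'"
    proof (rule PiE_ext)
      show "z \<in> {..<k} \<rightarrow>\<^sub>E UNIV" "z' \<in> {..<k} \<rightarrow>\<^sub>E UNIV"
        using z by (auto simp: S_def topspace_complex_space)
      fix i assume "i \<in> {..<k}"
      then consider "i = 0" | "i = 1" | "i = k - 1" | "i < k - 1" "i \<noteq> 0" "i \<noteq> 1" by fastforce
      then show "z i = z' i"
        using 01 last b[of i] by cases (auto simp: base_def)
    qed
  qed
  from card_inj_on_le[OF this sub finT] inj_on_finite[OF this sub finT] cardT show ?thesis by auto
qed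

text \<open>A vector \<open>\<xi>\<close> in the kernel vanishes for reasons that follow the composition from the outside inwards. The
rows other than the last say that \<open>\<xi>\<close> is annihilated by the differentials of \<open>base\<close>. Hence the cutoff
contributes nothing to the last row, which becomes a nonzero multiple of the last component of \<open>\<xi>\<close>. What
remains is the derivative of \<open>limmap 0\<close> applied to the first two components.\<close>

lemma jacobian_nonsingular:
  assumes z: "\<And>i. i < k \<Longrightarrow> root_map z i \<noteq> 0" "z (k - 1) \<noteq> 0" "(z 0, z 1) \<in> quadrant 2"
  shows "Determinant.det (jacobian_matrix k G z) \<noteq> 0"
proof
  let ?J = "jacobian_matrix k G z"
  have J: "?J \<in> carrier_mat k k" by (simp add: jacobian_matrix_def)
  assume "Determinant.det ?J = 0"
  then obtain x where x: "x \<in> carrier_vec k" "x \<noteq> 0\<^sub>v k" "?J *\<^sub>v x = 0\<^sub>v k"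
    using det_0_iff_vec_prod_zero[OF J] by blast
  define \<xi> where "\<xi> = vec_index x"
  have row: "(\<Sum>j<k. deriv (\<lambda>t. G (z(j := t)) i) (z j) * \<xi> j) = 0" if i: "i < k" for i
  proof -
    have "vec_index (?J *\<^sub>v x) i = 0" using i x(3) by simp
    then show ?thesis
      using i x(1) by (simp add: jacobian_matrix_def scalar_prod_def \<xi>_def atLeast0LessThan)
  qed
  define d where "d i j = deriv (\<lambda>t. base (z(j := t)) i) (z j)" for i j
  have d: "((\<lambda>t. base (z(j := t)) i) has_field_derivative d i j) (at (z j))" if "i < k" for i j
    unfolding d_def using base_holomorphic[of "\<lambda>t. z(j := t)", OF fun_upd_holomorphic that]
    by (intro holomorphic_derivI[of _ UNIV]) auto
  have D0: "(\<Sum>j<k. d i j * \<xi> j) = 0" if i: "i < k - 1" for i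
  proof -
    have "deriv (\<lambda>t. G (z(j := t)) i) (z j) = of_nat n * base z i ^ (n - 1) * d i j" for j
    proof (rule DERIV_imp_deriv)
      have "((\<lambda>t. base (z(j := t)) i ^ n) has_field_derivative of_nat n * base z i ^ (n - 1) * d i j) (at (z j))"
        using i by (auto intro!: derivative_eq_intros d)
      moreover have "G y i = base y i ^ n" for y
      proof -
        have "i < k" using i by simp
        with i show ?thesis by (simp add: G_def root_map_def)
      qed
      ultimately show "((\<lambda>t. G (z(j := t)) i) has_field_derivative of_nat n * base z i ^ (n - 1) * d i j) (at (z j))"
        by simp
    qed
    then have "of_nat n * base z i ^ (n - 1) * (\<Sum>j<k. d i j * \<xi> j) = 0"
      using row[of i] i by (simp add: sum_distrib_left mult.assoc)
    moreover have "base z i \<noteq> 0" using z(1)[of i] i by (simp add: root_map_def)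
    ultimately show ?thesis using n by simp
  qed
  let ?l = "k - 1" and ?h = "cutoff (base z)"
  have last: "\<xi> ?l = 0"
  proof -
    define c where "c j = (\<Sum>i<?l. of_nat m * base z i ^ (m - 1) * d i j)" for j
    define e where "e j = (if j = ?l then 4 * z ?l ^ 3 else 0)" for j
    have "deriv (\<lambda>t. G (z(j := t)) ?l) (z j) =
        of_nat n * root_map z ?l ^ (n - 1) * (e j - of_real M * ?h * of_real a * c j)" for j
    proof (rule DERIV_imp_deriv)
      have 1: "((\<lambda>t. (z(j := t)) ?l ^ 4) has_field_derivative e j) (at (z j))"
        by (cases "j = ?l") (auto simp: e_def intro!: derivative_eq_intros)
      have 2: "((\<lambda>t. cutoff (base (z(j := t)))) has_field_derivative - (?h * of_real a * c j)) (at (z j))"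
        unfolding cutoff_def c_def
        by (auto intro!: derivative_eq_intros d sum.cong simp: sum_distrib_left algebra_simps)
      have "((\<lambda>t. (z(j := t)) ?l ^ 4 - of_real M * (1 - cutoff (base (z(j := t))))) has_field_derivative
          (e j - of_real M * (0 - - (?h * of_real a * c j)))) (at (z j))"
        by (intro DERIV_diff DERIV_cmult DERIV_const 1 2)
      then have "((\<lambda>t. root_map (z(j := t)) ?l) has_field_derivative
          (e j - of_real M * ?h * of_real a * c j)) (at (z j))"
        by (simp add: root_map_def mult.assoc)
      then show "((\<lambda>t. G (z(j := t)) ?l) has_field_derivative
          of_nat n * root_map z ?l ^ (n - 1) * (e j - of_real M * ?h * of_real a * c j)) (at (z j))"
        using idx by (auto simp: G_def intro!: derivative_eq_intros)
    qed
    then have "of_nat n * root_map z ?l ^ (n - 1) *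
        (\<Sum>j<k. (e j - of_real M * ?h * of_real a * c j) * \<xi> j) = 0"
      using row[of ?l] idx by (simp add: sum_distrib_left mult.assoc)
    then have "(\<Sum>j<k. (e j - of_real M * ?h * of_real a * c j) * \<xi> j) = 0"
      using n z(1)[of ?l] idx by simp
    then have "(\<Sum>j<k. e j * \<xi> j) = of_real M * ?h * of_real a * (\<Sum>j<k. c j * \<xi> j)"
      by (simp add: left_diff_distrib sum_subtractf sum_distrib_left mult.assoc)
    moreover have "(\<Sum>j<k. c j * \<xi> j) = 0"
    proof -
      have "(\<Sum>j<k. c j * \<xi> j) = (\<Sum>i<?l. \<Sum>j<k. of_nat m * base z i ^ (m - 1) * d i j * \<xi> j)"
        unfolding c_def sum_distrib_right by (rule sum.swap)
      also have "\<dots> = (\<Sum>i<?l. of_nat m * base z i ^ (m - 1) * (\<Sum>j<k. d i j * \<xi> j))"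
        by (simp add: sum_distrib_left mult.assoc)
      also have "\<dots> = 0" using D0 by simp
      finally show ?thesis .
    qed
    moreover have "(\<Sum>j<k. e j * \<xi> j) = 4 * z ?l ^ 3 * \<xi> ?l"
    proof -
      have "(\<Sum>j<k. e j * \<xi> j) = (\<Sum>j<k. if j = ?l then 4 * z ?l ^ 3 * \<xi> j else 0)"
        by (intro sum.cong) (auto simp: e_def)
      also have "\<dots> = 4 * z ?l ^ 3 * \<xi> ?l"
        using idx(2) by (subst sum.delta) auto
      finally show ?thesis .
    qed
    ultimately show ?thesis using z(2) by simp
  qed
  have mid: "\<xi> i = 0" if i: "2 \<le> i" "i < k" for i
  proof (cases "i = ?l")
    case False
    then have il: "i < k - 1" using i by simp
    have "d i j = (if j = i then 1 else 0)" for j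
      unfolding d_def using i by (auto simp: base_def intro!: DERIV_imp_deriv derivative_eq_intros)
    then show ?thesis using D0[OF il] i by (simp add: if_distrib[of "\<lambda>x. x * _"] sum.delta cong: if_cong)
  qed (use last in simp)
  have two: "(\<Sum>j<k. d i j * \<xi> j) = d i 0 * \<xi> 0 + d i 1 * \<xi> 1" for i
  proof -
    have "(\<Sum>j<k. d i j * \<xi> j) = (\<Sum>j\<in>{0, 1}. d i j * \<xi> j)"
    proof (rule sum.mono_neutral_right)
      show "\<forall>j\<in>{..<k} - {0, 1}. d i j * \<xi> j = 0"
      proof
        fix j assume "j \<in> {..<k} - {0, 1}"
        then have "2 \<le> j" "j < k" by auto
        then show "d i j * \<xi> j = 0" by (simp add: mid)
      qed
    qed (use idx in auto)
    then show ?thesis by simp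
  qed
  have hol: "(\<lambda>t. fst (limmap 0 (t, z 1))) holomorphic_on UNIV"
    "(\<lambda>t. fst (limmap 0 (z 0, t))) holomorphic_on UNIV"
    "(\<lambda>t. snd (limmap 0 (t, z 1))) holomorphic_on UNIV"
    "(\<lambda>t. snd (limmap 0 (z 0, t))) holomorphic_on UNIV"
    by (intro limmap_holomorphic holomorphic_intros)+
  have shift: "deriv (\<lambda>t. f t + c) x = deriv f x" if "f holomorphic_on UNIV" for f :: "complex \<Rightarrow> complex" and c x
    using that by (simp add: holomorphic_on_def)
  have bump: "bump (z(0 := t)) = bump z" "bump (z(1 := t)) = bump z" for t
    using idx by (simp_all add: bump_def)
  have upd: "(\<lambda>t. base (z(0 := t)) 0) = (\<lambda>t. fst (limmap 0 (t, z 1)) + 8011 * bump z)"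
    "(\<lambda>t. base (z(1 := t)) 0) = (\<lambda>t. fst (limmap 0 (z 0, t)) + 8011 * bump z)"
    "(\<lambda>t. base (z(0 := t)) 1) = (\<lambda>t. snd (limmap 0 (t, z 1)) + 8011 * bump z)"
    "(\<lambda>t. base (z(1 := t)) 1) = (\<lambda>t. snd (limmap 0 (z 0, t)) + 8011 * bump z)"
    by (simp_all only: base_def bump) simp_all
  have d01: "d 0 0 = deriv (\<lambda>t. fst (limmap 0 (t, z 1))) (z 0)"
    "d 0 1 = deriv (\<lambda>t. fst (limmap 0 (z 0, t))) (z 1)"
    "d 1 0 = deriv (\<lambda>t. snd (limmap 0 (t, z 1))) (z 0)"
    "d 1 1 = deriv (\<lambda>t. snd (limmap 0 (z 0, t))) (z 1)"
    unfolding d_def upd by (rule shift, rule hol)+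
  have kernel: "d 0 0 * \<xi> 0 + d 0 1 * \<xi> 1 = 0" "d 1 0 * \<xi> 0 + d 1 1 * \<xi> 1 = 0"
    using D0[OF idx(6)] D0[OF idx(7)] by (simp_all only: two)
  note partials = limmap_partials[OF z(3), unfolded fst_conv snd_conv, folded d01]
  have "\<xi> 0 = 0" "\<xi> 1 = 0"
    by (rule near_identity_2x2_kernel[OF partials kernel])+
  then have "\<xi> i = 0" if "i < k" for i
    using mid[of i] that by (cases "i = 0"; cases "i = 1"; simp)
  then have "x = 0\<^sub>v k" using x(1) by (intro eq_vecI) (auto simp: \<xi>_def)
  with x(2) show False by simp
qed

text \<open>On the preimage of the closed polydisc both cutoffs are close to 1: their exponents are bounded there by
\<open>a * real k\<close> and \<open>A * c ^ (r + 1)\<close>. So the shear by \<open>bump\<close> must have come from values of \<open>limmap 0\<close> near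
\<open>(- 8011, - 8011)\<close>, which are not attained.\<close>

lemma range_avoids_polydisc:
  assumes q: "q = 4 * r + 1" and a: "0 \<le> a" "a * real k \<le> 1" and M: "0 \<le> M" and A: "A > 0"
    and c: "1 + 3 * M * (a * real k) \<le> c" and Ac: "8011 * 3 * A * c ^ (r + 1) \<le> 1"
  shows "\<not> (\<forall>j<k. cmod (G z j) \<le> 1)"
proof
  assume "\<forall>j<k. cmod (G z j) \<le> 1"
  have root: "cmod (root_map z j) \<le> 1" if "j < k" for j
  proof -
    have "cmod (root_map z j) ^ n \<le> 1 ^ n"
      using \<open>\<forall>j<k. cmod (G z j) \<le> 1\<close> that by (simp add: G_def flip: norm_power)
    then show ?thesis using n by (subst (asm) power_mono_iff) auto
  qed
  have base: "cmod (base z j) \<le> 1" if "j < k - 1" for j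
  proof -
    have "j < k" using that by simp
    from root[OF this] show ?thesis using that by (simp add: root_map_def)
  qed
  let ?y = "z (k - 1)" and ?s = "of_real a * (\<Sum>i<k - 1. base z i ^ m)"
  have "cmod (\<Sum>i<k - 1. base z i ^ m) \<le> (\<Sum>i<k - 1. 1)"
    using base by (intro sum_norm_le) (simp add: norm_power power_le_one)
  then have s: "cmod ?s \<le> a * real k"
    using a(1) by (simp add: norm_mult) (smt (verit) mult_left_mono of_nat_mono diff_le_self)
  have "cmod (1 - cutoff (base z)) = cmod (exp (- ?s) - 1)"
    by (simp add: cutoff_def norm_minus_commute)
  also have "\<dots> \<le> 3 * cmod (- ?s)" using s a by (intro norm_exp_minus_one_le) simp
  also have "\<dots> \<le> 3 * (a * real k)" using s by simp
  finally have cut: "cmod (1 - cutoff (base z)) \<le> 3 * (a * real k)" .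
  \<comment> \<open>The fourth power of \<open>?y\<close> is the last coordinate with the shear undone, so it stays close to the unit disc.\<close>
  have "?y ^ 4 = root_map z (k - 1) + of_real M * (1 - cutoff (base z))"
    by (simp add: root_map_def)
  then have "cmod (?y ^ 4) \<le> cmod (root_map z (k - 1)) + cmod (of_real M * (1 - cutoff (base z)))"
    by (metis norm_triangle_ineq)
  also have "\<dots> \<le> 1 + M * (3 * (a * real k))"
    using root[OF idx(2)] mult_left_mono[OF cut M] M by (simp add: norm_mult)
  finally have y4: "cmod ?y ^ 4 \<le> c" using c by (simp add: norm_power)
  have c1: "1 \<le> c" using c M a by (smt (verit) mult_nonneg_nonneg of_nat_0_le_iff)
  have yc: "cmod ?y \<le> c"
  proof (cases "cmod ?y \<le> 1")
    case False
    then have "cmod ?y ^ 1 \<le> cmod ?y ^ 4" by (intro power_increasing) auto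
    with y4 show ?thesis by simp
  qed (use c1 in simp)
  have "cmod ?y ^ q = (cmod ?y ^ 4) ^ r * cmod ?y" by (simp add: q power_add power_mult)
  also have "\<dots> \<le> c ^ r * c" using y4 yc c1 by (intro mult_mono power_mono) auto
  finally have yq: "A * cmod ?y ^ q \<le> A * c ^ (r + 1)"
    using A by (intro mult_left_mono) (auto simp: mult.commute)
  then have yq': "cmod (of_real A * ?y ^ q) \<le> A * c ^ (r + 1)"
    using A by (simp add: norm_mult norm_power)
  have "cmod (1 - bump z) = cmod (exp (- (of_real A * ?y ^ q)) - 1)"
    by (simp add: bump_def norm_minus_commute)
  also have "\<dots> \<le> 3 * cmod (- (of_real A * ?y ^ q))"
    using yq' Ac by (intro norm_exp_minus_one_le) simp
  also have "\<dots> \<le> 3 * (A * c ^ (r + 1))" using yq' by simp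
  finally have bump: "8011 * cmod (1 - bump z) \<le> 1" using Ac by simp
  have region: "w \<in> left_region 0" if "cmod (w + 8011 * bump z) \<le> 1" for w
  proof -
    have "w + 8011 = (w + 8011 * bump z) + 8011 * (1 - bump z)" by (simp add: algebra_simps)
    then have "cmod (w + 8011) \<le> cmod (w + 8011 * bump z) + cmod (8011 * (1 - bump z))"
      by (metis norm_triangle_ineq)
    moreover have "cmod (8011 * (1 - bump z)) = 8011 * cmod (1 - bump z)"
      by (simp only: norm_mult norm_numeral)
    ultimately have "cmod (w + 8011) \<le> 2" using that bump by linarith
    then have "\<bar>Re w + 8011\<bar> \<le> 2" "\<bar>Im w\<bar> \<le> 2"
      using abs_Re_le_cmod[of "w + 8011"] abs_Im_le_cmod[of "w + 8011"] by auto
    then show ?thesis by (simp add: left_region_def tol_def)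
  qed
  show False
    using limmap_avoids[OF region region, of "(z 0, z 1)"] base[of 0] base[of 1] idx
    by (simp add: base_def)
qed

text \<open>The choice of roots makes both cutoffs harmless. If the large coordinate \<open>l\<close> is not the last one, then
\<open>cutoff v\<close> has modulus at most 1/2 and the shear by \<open>M = 2 * c\<close> moves the last coordinate to the right by at
least \<open>c\<close>; if it is the last one, the shear does no harm, because it never moves a point to the left.\<close>

lemma range_covers:
  assumes b: "b \<ge> 2" and n_eq: "n = 4 * b" and m_eq: "m = 4 * b * j + b" and q: "q = 4 * r + 1"
    and a: "0 \<le> a" and A: "A \<ge> 0" and c: "1 < c" "c ^ n \<le> (1 + \<epsilon>) * cos (pi / b) ^ n" and M: "M = 2 * c"
    and small_cutoff: "exp (- (a * c ^ m / 2)) \<le> 1 / 2"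
    and small_bump: "8011 * exp (- (A * c ^ r / 2)) \<le> 1"
    and w: "w \<in> topspace (complex_space k)" "l < k" "cmod (w l) \<ge> 1 + \<epsilon>"
  obtains z where "z \<in> topspace (complex_space k)" "G z = w" "z (k - 1) \<noteq> 0" "(z 0, z 1) \<in> quadrant 2"
proof -
  have cos0: "0 \<le> cos (pi / b)" 
  proof (rule cos_ge_zero)
    have "0 \<le> pi / b" by simp
    then show "- (pi / 2) \<le> pi / b" using pi_gt_zero by linarith
    show "pi / b \<le> pi / 2" using b by (intro divide_left_mono) auto
  qed
  have "\<exists>v. v ^ n = w i \<and> Re v \<ge> cmod v * cos (pi / b) \<and> Re (v ^ m) \<ge> cmod v ^ m / 2" for i
    using root_in_sector_with_near_real_power[of b "w i" j] b unfolding n_eq m_eq by auto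
  then obtain v where v: "\<And>i. v i ^ n = w i" "\<And>i. Re (v i) \<ge> cmod (v i) * cos (pi / b)"
    "\<And>i. Re (v i ^ m) \<ge> cmod (v i) ^ m / 2" by metis
  have v0: "0 \<le> Re (v i)" for i using v(2)[of i] cos0 by (smt (verit) mult_nonneg_nonneg norm_ge_zero)
  have vm0: "0 \<le> Re (v i ^ m)" for i using v(3)[of i] by (smt (verit) zero_le_power norm_ge_zero divide_nonneg_pos)
  have l: "c \<le> cmod (v l) * cos (pi / b)"
  proof (rule power_le_imp_le_base)
    have "(1 + \<epsilon>) * cos (pi / b) ^ n \<le> cmod (v l) ^ n * cos (pi / b) ^ n"
      using w(3) cos0 by (intro mult_right_mono) (auto simp flip: v(1)[of l] norm_power)
    with c(2) have "c ^ n \<le> (cmod (v l) * cos (pi / b)) ^ n" by (simp add: power_mult_distrib)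
    then show "c ^ Suc (n - 1) \<le> (cmod (v l) * cos (pi / b)) ^ Suc (n - 1)" using n by simp
  qed (use cos0 in simp)
  define h where "h = cutoff v"
  define u where "u = v (k - 1) + of_real M * (1 - h)"
  have norm_h: "cmod h = exp (- (a * (\<Sum>i<k - 1. Re (v i ^ m))))"
    by (simp add: h_def cutoff_def)
  have "cmod h \<le> 1" unfolding norm_h using a vm0 by (simp add: sum_nonneg)
  then have Re_h: "Re h \<le> 1" using complex_Re_le_cmod order_trans by blast
  have Re_u: "Re u = Re (v (k - 1)) + M * (1 - Re h)" by (simp add: u_def)
  have "c \<le> Re u"
  proof (cases "l = k - 1")
    case True
    have "0 \<le> M * (1 - Re h)" using Re_h M c by simp
    then show ?thesis using l v(2)[of l] True Re_u by simp
  next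
    case False
    then have lk: "l < k - 1" using w(2) by simp
    have "cmod (v l) * cos (pi / b) \<le> cmod (v l) * 1" by (intro mult_left_mono) auto
    then have "c ^ m \<le> cmod (v l) ^ m" using l c by (intro power_mono) auto
    then have "c ^ m / 2 \<le> Re (v l ^ m)" using v(3)[of l] by simp
    also have "\<dots> \<le> (\<Sum>i<k - 1. Re (v i ^ m))"
      using lk vm0 by (intro member_le_sum) auto
    finally have "a * c ^ m / 2 \<le> a * (\<Sum>i<k - 1. Re (v i ^ m))"
      using a mult_left_mono by fastforce
    then have "cmod h \<le> 1 / 2" unfolding norm_h using small_cutoff by (smt (verit) exp_le_cancel_iff)
    then have "1 / 2 \<le> 1 - Re h" using complex_Re_le_cmod[of h] by simp
    then have "M * (1 / 2) \<le> M * (1 - Re h)" using M c by (intro mult_left_mono) auto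
    then show ?thesis using Re_u v0[of "k - 1"] M by simp
  qed
  then have cu: "c \<le> cmod u" using complex_Re_le_cmod[of u] by simp
  obtain y where y: "y ^ 4 = u" "Re (u ^ r * y) \<ge> cmod (u ^ r * y) / 2"
    by (rule fourth_root_near_real_power)
  have y0: "y \<noteq> 0" using y(1) cu c by auto
  have y1: "1 \<le> cmod y"
  proof (rule ccontr)
    assume "\<not> 1 \<le> cmod y"
    then have "cmod y ^ 4 \<le> 1" by (intro power_le_one) auto
    then show False using y(1) cu c by (simp flip: norm_power)
  qed
  have yq: "y ^ q = u ^ r * y" by (simp add: q power_add power_mult y(1))
  have "c ^ r * 1 \<le> cmod u ^ r * cmod y" using cu c y1 by (intro mult_mono power_mono) auto
  then have "c ^ r / 2 \<le> Re (y ^ q)" using y(2) by (simp add: yq norm_mult norm_power)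
  then have "A * c ^ r / 2 \<le> A * Re (y ^ q)" using A mult_left_mono by fastforce
  then have exp_le: "exp (- (A * Re (y ^ q))) \<le> exp (- (A * c ^ r / 2))" by simp
  define e where "e = exp (- (of_real A * y ^ q))"
  have "cmod e = exp (- (A * Re (y ^ q)))" by (simp add: e_def)
  moreover have "cmod (8011 * e) = 8011 * cmod e" by (simp only: norm_mult norm_numeral)
  ultimately have e: "cmod (8011 * e) \<le> 1" using small_bump exp_le by linarith
  have "(v 0 - 8011 * e, v 1 - 8011 * e) \<in> quadrant 1"
    using v0[of 0] v0[of 1] e complex_Re_le_cmod[of "8011 * e"] by (simp add: quadrant_def)
  then obtain p where p: "limmap 0 p = (v 0 - 8011 * e, v 1 - 8011 * e)" "p \<in> quadrant 2"
    by (rule limmap_covers)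
  define z where "z = (\<lambda>i\<in>{..<k}. if i = 0 then fst p else if i = 1 then snd p
    else if i = k - 1 then y else v i)"
  have z: "z 0 = fst p" "z 1 = snd p" "z (k - 1) = y"
    "\<And>i. i \<noteq> 0 \<Longrightarrow> i \<noteq> 1 \<Longrightarrow> i < k - 1 \<Longrightarrow> z i = v i"
    using idx by (auto simp: z_def)
  have "bump z = e" by (simp only: bump_def z e_def)
  then have base: "base z i = v i" if "i < k - 1" for i
    using that z(4)[of i] p(1) by (simp only: base_def z prod.collapse) simp
  then have "cutoff (base z) = h" by (simp add: h_def cutoff_def)
  then have "root_map z i = v i" if "i < k" for i
    using that base[of i] z(3) y(1) by (auto simp: root_map_def u_def)
  then have "G z i = w i" if "i < k" for i using that v(1) by (simp add: G_def)
  moreover have "w i = undefined" if "\<not> i < k" for i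
    using w(1) that by (simp add: topspace_complex_space PiE_def extensional_def)
  ultimately have "G z = w" by (auto simp: G_def)
  moreover have "z \<in> topspace (complex_space k)" by (simp add: topspace_complex_space z_def)
  ultimately show ?thesis using that p(2) z y0 by simp
qed

end

lemma exp_minus_le: "0 < x \<Longrightarrow> 1 / x \<le> t \<Longrightarrow> exp (- t) \<le> (x::real)"
proof -
  assume x: "0 < x" "1 / x \<le> t"
  then have "1 / x \<le> exp t" using exp_ge_add_one_self[of t] by linarith
  then show ?thesis using x by (simp add: exp_minus field_simps)
qed

theorem theorem1p1:
  fixes \<epsilon> :: real
  assumes "\<epsilon> > 0"
  shows "\<exists>n::nat. n > 0 \<and>
    (\<forall>k::nat. k \<ge> 3 \<longrightarrow>
      (\<exists>G :: (nat \<Rightarrow> complex) \<Rightarrow> (nat \<Rightarrow> complex).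
         entire_map k G \<and> nondegenerate k G \<and>
         G ` topspace (complex_space k) \<inter> (complex_space k closure_of polydisc k 1) = {} \<and>
         topspace (complex_space k) - polydisc k (1 + \<epsilon>) \<subseteq> G ` topspace (complex_space k) \<and>
         (\<forall>w \<in> G ` topspace (complex_space k).
            finite {z \<in> topspace (complex_space k). G z = w} \<and>
            card {z \<in> topspace (complex_space k). G z = w} \<le> n ^ k)))"
proof -
  obtain b where b: "b \<ge> 2" "(1 + \<epsilon>) * cos (pi / real b) ^ (4 * b) > 1"
    using exists_narrow_sector[OF assms] by blast
  define n where "n = 4 * b"
  have n: "n > 0" using b(1) by (simp add: n_def)
  define c where "c = root n ((1 + \<epsilon>) * cos (pi / b) ^ n)"
  have c: "c > 1" "c ^ n = (1 + \<epsilon>) * cos (pi / b) ^ n"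
    using b(2) n by (auto simp: c_def n_def)
  show ?thesis
  proof (intro exI[of _ "4 * n"] conjI allI impI)
    fix k :: nat assume k: "k \<ge> 3"
    \<comment> \<open>Over the closed unit polydisc, this \<open>a\<close> bounds the fourth power of the last coordinate by the midpoint \<open>c'\<close> of 1 and \<open>c\<close>.\<close>
    define a where "a = (c - 1) / (12 * c * real k)"
    have a: "a > 0" using c k by (simp add: a_def)
    have ak: "a * real k = (c - 1) / (12 * c)" using k by (simp add: a_def)
    define c' where "c' = (1 + c) / 2"
    have c': "1 < c'" "c' < c" using c by (simp_all add: c'_def)
    have c'a: "1 + 3 * (2 * c) * (a * real k) \<le> c'"
      using c unfolding ak by (simp add: c'_def field_simps)
    \<comment> \<open>The exponents are chosen last: powers of \<open>c\<close> and of \<open>c / c'\<close> beat any constant.\<close>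
    obtain j where j: "4 / a < c ^ j" using real_arch_pow[OF c(1)] by blast
    define m where "m = 4 * b * j + b"
    have "exp (- (a * c ^ m / 2)) \<le> 1 / 2"
    proof (rule exp_minus_le)
      have "1 * j \<le> 4 * b * j" using b(1) by (intro mult_right_mono) auto
      then have "j \<le> m" unfolding m_def by linarith
      then have "c ^ j \<le> c ^ m" using c(1) by (intro power_increasing) auto
      with j have "4 / a \<le> c ^ m" by simp
      then show "1 / (1 / 2) \<le> a * c ^ m / 2" using a by (simp add: field_simps)
    qed simp
    moreover have "c / c' > 1" using c' by simp
    then obtain r where r: "2 * 8011 * (8011 * 3 * c') < (c / c') ^ r" using real_arch_pow by blast
    define A where "A = 1 / (8011 * 3 * c' ^ (r + 1))"
    have A: "A > 0" using c' by (simp add: A_def)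
    have Ac: "8011 * 3 * A * c' ^ (r + 1) \<le> 1" using c' by (simp add: A_def)
    have "exp (- (A * c ^ r / 2)) \<le> 1 / 8011"
    proof (rule exp_minus_le)
      have "A * c ^ r = (c / c') ^ r / (8011 * 3 * c')" using c' by (simp add: A_def power_divide field_simps)
      moreover have "2 * 8011 \<le> (c / c') ^ r / (8011 * 3 * c')"
        using r c' by (subst pos_le_divide_eq) auto
      ultimately show "1 / (1 / 8011) \<le> A * c ^ r / 2" by simp
    qed simp
    ultimately have small: "exp (- (a * c ^ m / 2)) \<le> 1 / 2" "8011 * exp (- (A * c ^ r / 2)) \<le> 1"
      by simp_all
    interpret covering_map k n m "4 * r + 1" a A "2 * c"
      by unfold_locales (use k n in auto)
    have covers: "\<exists>z \<in> topspace (complex_space k). G z = w \<and> z (k - 1) \<noteq> 0 \<and> (z 0, z 1) \<in> quadrant 2"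
      if "w \<in> topspace (complex_space k)" "l < k" "cmod (w l) \<ge> 1 + \<epsilon>" for w l
      by (rule range_covers[OF b(1) n_def m_def refl less_imp_le[OF a] less_imp_le[OF A] c(1)
          eq_refl[OF c(2)] refl small that]) blast
    have "nondegenerate k G"
    proof -
      define w :: "nat \<Rightarrow> complex" where "w = (\<lambda>i\<in>{..<k}. of_real (1 + \<epsilon>))"
      have "w \<in> topspace (complex_space k)" "cmod (w 0) \<ge> 1 + \<epsilon>"
        using idx assms unfolding w_def topspace_complex_space by (auto simp del: of_real_add)
      with covers idx obtain z where z: "z \<in> topspace (complex_space k)" "G z = w" "z (k - 1) \<noteq> 0"
        "(z 0, z 1) \<in> quadrant 2" by metis
      have "root_map z i \<noteq> 0" if "i < k" for i
      proof -
        have "root_map z i ^ n = w i" by (simp only: z(2) flip: G_apply[OF that])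
        then have "root_map z i ^ n = of_real (1 + \<epsilon>)" using that by (simp only: w_def restrict_apply' lessThan_iff)
        moreover have "1 + \<epsilon> \<noteq> 0" using assms by simp
        ultimately show ?thesis using n by (metis of_real_eq_0_iff zero_power)
      qed
      from jacobian_nonsingular[OF this z(3,4)] z(1) show ?thesis by (auto simp: nondegenerate_def)
    qed
    moreover have "G ` topspace (complex_space k) \<inter> (complex_space k closure_of polydisc k 1) = {}"
    proof -
      have "a * real k \<le> 1" using c unfolding ak by (simp add: field_simps)
      then have "\<not> (\<forall>j<k. cmod (G z j) \<le> 1)" for z
        using range_avoids_polydisc[OF refl less_imp_le[OF a] _ _ A c'a Ac] c by simp
      then show ?thesis using closure_polydisc_subset[of k] by blast
    qed
    moreover have "topspace (complex_space k) - polydisc k (1 + \<epsilon>) \<subseteq> G ` topspace (complex_space k)"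
    proof
      fix w assume "w \<in> topspace (complex_space k) - polydisc k (1 + \<epsilon>)"
      then obtain l where "w \<in> topspace (complex_space k)" "l < k" "cmod (w l) \<ge> 1 + \<epsilon>"
        by (auto simp: polydisc_def not_less)
      with covers show "w \<in> G ` topspace (complex_space k)" by blast
    qed
    ultimately show "\<exists>G. entire_map k G \<and> nondegenerate k G \<and>
         G ` topspace (complex_space k) \<inter> (complex_space k closure_of polydisc k 1) = {} \<and>
         topspace (complex_space k) - polydisc k (1 + \<epsilon>) \<subseteq> G ` topspace (complex_space k) \<and>
         (\<forall>w \<in> G ` topspace (complex_space k).
            finite {z \<in> topspace (complex_space k). G z = w} \<and>
            card {z \<in> topspace (complex_space k). G z = w} \<le> (4 * n) ^ k)"
      using entire_map_G fibre_bound by (intro exI[of _ G] conjI ballI) auto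
  qed (use n in simp)
qed

end
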